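(* For $1\le j\le n$, the maps $\widetilde{\mathbb V}_j$ and $\mathbb V_j$ are strictly log-convex on $\mathcal F_{n,d}$; that is, for all $f,g\in\mathcal F_{n,d}$ with $f\ne g$ and all $\lambda\in(0,1)$, $$\mathbb V_j(\lambda f+(1-\lambda)g)< \mathbb V_j(f)^{\lambda}\,\mathbb V_j(g)^{1-\lambda}\qquad\text{and}\qquad \widetilde{\mathbb V}_j(\lambda f+(1-\lambda)g)< \widetilde{\mathbb V}_j(f)^{\lambda}\,\widetilde{\mathbb V}_j(g)^{1-\lambda}.$$
   Context: Fix natural numbers $n\ge2$ and $d\ge2$ with $d$ even. $\mathcal F_{n,d}$ is the set of positively $d$-homogeneous polynomials $f:\mathbb R^n\to\mathbb R$ ($f(\lambda x)=\lambda^df(x)$ for $\lambda>0$) with $f(x)>0$ for all $x\neq0$. $G(j,n)$ is the Grassmannian of $j$-dimensional linear subspaces of $\mathbb R^n$ with its rotation-invariant (Haar) probability measure $\nu_j$; $\kappa_m$ is the volume of the unit ball of $\mathbb R^m$. For $E\in G(j,n)$, $y\in E$: $\Pi_Ef(y):=\inf_{z\in E^\perp}f(y+z)$ and $\mathscr R_Ef:=f|_E$. Set $\beta_{j,n}=\binom nj\frac{\kappa_n}{\kappa_j\kappa_{n-j}}$ and $\sigma_{j,n}=\frac{\kappa_n}{\kappa_{n-j}}$. For $f\in\mathcal F_{n,d}$ and $1\le j\le n-1$, $$\mathbb V_j(f):=\frac{\beta_{j,n}}{\Gamma(1+j/d)}\int_{G(j,n)}\int_E e^{-\Pi_Ef(y)}\,dy\,d\nu_j(E),\qquad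 \widetilde{\mathbb V}_j(f):=\frac{\sigma_{j,n}}{\Gamma(1+j/d)}\int_{G(j,n)}\int_E e^{-\mathscr R_Ef(y)}\,dy\,d\nu_j(E),$$ and $\mathbb V_n(f)=\widetilde{\mathbb V}_n(f):=\frac1{\Gamma(1+n/d)}\int_{\mathbb R^n}e^{-f(x)}\,dx$. These quantities are finite on $\mathcal F_{n,d}$. *)

theory Defs
  imports "HOL-Analysis.Analysis"
begin

section \<open>The space of functions\<close>

definition pos_hom_polys :: "nat \<Rightarrow> (real^'n \<Rightarrow> real) set" where
  "pos_hom_polys d =
     {f. real_polynomial_function f \<and>
         (\<forall>x. \<forall>r>0. f (r *\<^sub>R x) = r ^ d * f x) \<and>
         (\<forall>x. x \<noteq> 0 \<longrightarrow> f x > 0)}"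

section \<open>Lebesgue measure on a linear subspace\<close>

definition orthonormal_basis_of :: "'a::euclidean_space set \<Rightarrow> 'a set \<Rightarrow> bool" where
  "orthonormal_basis_of E B \<longleftrightarrow>
     B \<subseteq> E \<and> pairwise orthogonal B \<and> (\<forall>b\<in>B. norm b = 1) \<and> span B = E"

text \<open>This mirrors \<open>lborel_def\<close>, with \<open>Basis\<close> replaced by an orthonormal basis of \<open>E\<close>; the
  result does not depend on the basis, because Lebesgue measure is invariant under orthogonal maps.
  It is a measure on the whole space that is concentrated on \<open>E\<close>.\<close>

definition subspace_lborel :: "'a::euclidean_space set \<Rightarrow> 'a measure" where
  "subspace_lborel E =
     (let B = (SOME B. orthonormal_basis_of E B)
      in distr (\<Pi>\<^sub>M b\<in>B. lborel) borel (\<lambda>c. \<Sum>b\<in>B. c b *\<^sub>R b))"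

section \<open>The Grassmannian and its rotation-invariant probability measure\<close>

definition grassmannian :: "nat \<Rightarrow> (real^'n) set set" where
  "grassmannian j = {E. subspace E \<and> dim E = j}"

text \<open>The usual topology of the Grassmannian is the one obtained by identifying a subspace with the
  matrix of the orthogonal projection onto it; \<open>grassmann_borel j\<close> carries its Borel sets.\<close>

definition grassmann_borel :: "nat \<Rightarrow> (real^'n) set measure" where
  "grassmann_borel j = vimage_algebra (grassmannian j) (\<lambda>E. matrix (closest_point E)) borel"

definition is_grassmann_haar :: "nat \<Rightarrow> (real^'n) set measure \<Rightarrow> bool" where
  "is_grassmann_haar j \<nu> \<longleftrightarrow>
     sets \<nu> = sets (grassmann_borel j) \<and>
     emeasure \<nu> (space \<nu>) = 1 \<and>
     (\<forall>Q. rotation_matrix Q \<longrightarrow>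
        (\<forall>A\<in>sets \<nu>. emeasure \<nu> ((\<lambda>E. (*v) Q ` E) ` A) = emeasure \<nu> A))"

text \<open>Such a measure is unique; \<open>is_grassmann_haar_grassmann_haar\<close> below shows that it exists.\<close>

definition grassmann_haar :: "nat \<Rightarrow> (real^'n) set measure" where
  "grassmann_haar j = (SOME \<nu>. is_grassmann_haar j \<nu>)"

section \<open>The functionals\<close>

definition proj_fun :: "(real^'n) set \<Rightarrow> (real^'n \<Rightarrow> real) \<Rightarrow> real^'n \<Rightarrow> real" where
  "proj_fun E f y = (INF z\<in>E\<^sup>\<bottom>. f (y + z))"

definition flag_coeff :: "nat \<Rightarrow> nat \<Rightarrow> real" where
  "flag_coeff j n =
     real (n choose j) * (unit_ball_vol (real n) / (unit_ball_vol (real j) * unit_ball_vol (real (n - j))))"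

definition dual_coeff :: "nat \<Rightarrow> nat \<Rightarrow> real" where
  "dual_coeff j n = unit_ball_vol (real n) / unit_ball_vol (real (n - j))"

definition intrinsic_vol :: "nat \<Rightarrow> nat \<Rightarrow> (real^'n \<Rightarrow> real) \<Rightarrow> real" where
  "intrinsic_vol d j f =
     (if j = CARD('n)
      then 1 / Gamma (1 + real CARD('n) / real d) * (\<integral>x. exp (- f x) \<partial>lborel)
      else flag_coeff j CARD('n) / Gamma (1 + real j / real d) *
           (\<integral>E. (\<integral>y. exp (- proj_fun E f y) \<partial>subspace_lborel E) \<partial>grassmann_haar j))"

text \<open>The restriction of \<open>f\<close> to \<open>E\<close> needs no operation of its own, as \<open>subspace_lborel E\<close> is
  concentrated on \<open>E\<close>.\<close>

definition dual_intrinsic_vol :: "nat \<Rightarrow> nat \<Rightarrow> (real^'n \<Rightarrow> real) \<Rightarrow> real" where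
  "dual_intrinsic_vol d j f =
     (if j = CARD('n)
      then 1 / Gamma (1 + real CARD('n) / real d) * (\<integral>x. exp (- f x) \<partial>lborel)
      else dual_coeff j CARD('n) / Gamma (1 + real j / real d) *
           (\<integral>E. (\<integral>y. exp (- f y) \<partial>subspace_lborel E) \<partial>grassmann_haar j))"

section \<open>The two choices above are well-founded\<close>

lemma ex_orthonormal_basis_of: "subspace E \<Longrightarrow> \<exists>B. orthonormal_basis_of E B"
  unfolding orthonormal_basis_of_def by (metis orthonormal_basis_subspace)

text \<open>The rotation-invariant measure on the Grassmannian is obtained as the law of the span of the
  first \<open>j\<close> rows of a matrix that is uniformly distributed on the invertible matrices of norm less
  than \<open>1\<close>.\<close>

lemma lborel_orthogonal_le_open:
  fixes T :: "'a::euclidean_space \<Rightarrow> 'a"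
  assumes T: "orthogonal_transformation T" and U: "open U"
  shows "emeasure lborel (T ` U) \<le> emeasure lborel U"
proof -
  define K where "K = {(x, r). r > 0 \<and> ball x r \<subseteq> U}"
  have "\<exists>i. i \<in> K \<and> x \<in> ball (fst i) (snd i) \<and> snd i < d" if "x \<in> U" "0 < d" for x d
  proof -
    obtain e where "e > 0" "ball x e \<subseteq> U" using U \<open>x \<in> U\<close> openE by blast
    then have "(x, min e (d/2)) \<in> K" using \<open>0 < d\<close> by (auto simp: K_def)
    then show ?thesis using \<open>0 < d\<close> \<open>e > 0\<close> by (intro exI[of _ "(x, min e (d/2))"]) auto
  qed
  then obtain C where C: "countable C" "C \<subseteq> K"
     "pairwise (\<lambda>i j. disjnt (ball (fst i) (snd i)) (ball (fst j) (snd j))) C"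
     "negligible (U - (\<Union>i\<in>C. ball (fst i) (snd i)))"
    by (rule Vitali_covering_theorem_balls)
  let ?N = "U - (\<Union>i\<in>C. ball (fst i) (snd i))"
  have df: "disjoint_family_on (\<lambda>i. ball (fst i) (snd i)) C"
    using C(3) unfolding disjoint_family_on_def pairwise_def disjnt_def by auto
  have dfT: "disjoint_family_on (\<lambda>i. ball (T (fst i)) (snd i)) C"
    using df unfolding disjoint_family_on_def image_orthogonal_transformation_ball[OF T, symmetric]
    by (simp add: image_Int[OF orthogonal_transformation_inj[OF T], symmetric])
  have lin: "linear T" using T by (rule orthogonal_transformation_linear)
  have negN: "negligible (T ` ?N)"
    by (rule negligible_differentiable_image_negligible[OF order_refl C(4)])
       (use lin linear_imp_differentiable_on in blast)
  have "T ` ?N \<subseteq> T ` ?N" ..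
  have nT: "T ` ?N \<in> null_sets lebesgue"
    using negN negligible_iff_null_sets by blast
  have bU: "(\<Union>i\<in>C. ball (T (fst i)) (snd i)) \<in> sets borel"
    using C(1) by (intro sets.countable_UN'') auto
  have TU: "T ` U \<subseteq> (\<Union>i\<in>C. ball (T (fst i)) (snd i)) \<union> T ` ?N"
    using image_orthogonal_transformation_ball[OF T] by blast
  have openTU: "open (T ` U)"
    using T U lin by (simp add: open_surjective_linear_image orthogonal_transformation_surj)
  have "emeasure lborel (T ` U) = emeasure lebesgue (T ` U)"
    using openTU by simp
  also have "\<dots> \<le> emeasure lebesgue ((\<Union>i\<in>C. ball (T (fst i)) (snd i)) \<union> T ` ?N)"
    by (rule emeasure_mono[OF TU]) (use bU nT in auto)
  also have "\<dots> = emeasure lborel (\<Union>i\<in>C. ball (T (fst i)) (snd i))"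
    using bU nT by (subst emeasure_Un_null_set) auto
  also have "\<dots> = (\<integral>\<^sup>+i. emeasure lborel (ball (T (fst i)) (snd i)) \<partial>count_space C)"
    using C(1) dfT by (intro emeasure_UN_countable) auto
  also have "\<dots> = (\<integral>\<^sup>+i. emeasure lborel (ball (fst i) (snd i)) \<partial>count_space C)"
    using C(2) by (intro nn_integral_cong) (auto simp: K_def emeasure_ball)
  also have "\<dots> = emeasure lborel (\<Union>i\<in>C. ball (fst i) (snd i))"
    using C(1) df by (intro emeasure_UN_countable[symmetric]) auto
  also have "\<dots> \<le> emeasure lborel U"
    using C(2) U by (intro emeasure_mono) (force simp: K_def)+
  finally show ?thesis .
qed

lemma lborel_orthogonal_open:
  fixes T :: "'a::euclidean_space \<Rightarrow> 'a"
  assumes T: "orthogonal_transformation T" and U: "open U"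
  shows "emeasure lborel (T ` U) = emeasure lborel U"
proof (rule antisym)
  have T': "orthogonal_transformation (inv T)" using T by (rule orthogonal_transformation_inv)
  have "open (T ` U)"
    using T U by (simp add: open_surjective_linear_image orthogonal_transformation_surj
        orthogonal_transformation_linear)
  from lborel_orthogonal_le_open[OF T' this]
  show "emeasure lborel U \<le> emeasure lborel (T ` U)"
    using orthogonal_transformation_inj[OF T] by (simp add: image_inv_f_f)
qed (rule lborel_orthogonal_le_open[OF T U])

lemma lborel_orthogonal:
  fixes T :: "'a::euclidean_space \<Rightarrow> 'a"
  assumes T: "orthogonal_transformation T"
  shows "distr lborel borel T = (lborel :: 'a measure)"
proof -
  have meas: "T \<in> borel_measurable borel"
    using T linear_continuous_on linear_conv_bounded_linear orthogonal_transformation_linear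
    by (intro borel_measurable_continuous_onI) blast
  have T': "orthogonal_transformation (inv T)" using T by (rule orthogonal_transformation_inv)
  have eq: "emeasure lborel U = emeasure (distr lborel borel T) U" if "open U" for U
  proof -
    have "emeasure (distr lborel borel T) U = emeasure lborel (T -` U)"
      using that meas by (subst emeasure_distr) auto
    also have "T -` U = inv T ` U"
      by (simp add: T bij_vimage_eq_inv_image orthogonal_transformation_bij)
    finally show ?thesis using lborel_orthogonal_open[OF T' that] by simp
  qed
  show ?thesis
  proof (rule measure_eqI_generator_eq[where E="{U. open U}" and \<Omega>=UNIV and A="\<lambda>i. ball 0 (real i)", symmetric])
    show "Int_stable {U::'a set. open U}" by (auto simp: Int_stable_def)
    show "(\<Union>i. ball 0 (real i)) = (UNIV::'a set)"
      using reals_Archimedean2 by (force simp: dist_norm)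
    show "emeasure lborel (ball (0::'a) (real i)) \<noteq> \<infinity>" for i
      by (simp add: emeasure_ball)
  qed (use eq in \<open>auto simp: borel_def\<close>)
qed

lemma lborel_orthogonal_image:
  fixes T :: "'a::euclidean_space \<Rightarrow> 'a"
  assumes T: "orthogonal_transformation T" and A: "T ` A \<in> sets borel"
  shows "emeasure lborel (T ` A) = emeasure lborel A"
proof -
  have meas: "T \<in> borel_measurable borel"
    using T linear_continuous_on linear_conv_bounded_linear orthogonal_transformation_linear
    by (intro borel_measurable_continuous_onI) blast
  have "emeasure lborel (T ` A) = emeasure (distr lborel borel T) (T ` A)"
    by (simp add: lborel_orthogonal[OF T])
  also have "\<dots> = emeasure lborel (T -` (T ` A))"
    using A meas by (subst emeasure_distr) auto
  also have "T -` (T ` A) = A"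
    using orthogonal_transformation_inj[OF T] by (simp add: inj_vimage_image_eq)
  finally show ?thesis .
qed

lemma closest_point_subspaceI:
  fixes E :: "'a::euclidean_space set"
  assumes E: "subspace E" and y: "y \<in> E" and orth: "\<And>z. z \<in> E \<Longrightarrow> (x - y) \<bullet> z = 0"
  shows "closest_point E x = y"
proof -
  have "dist x y \<le> dist x z" if z: "z \<in> E" for z
  proof -
    have "(x - y) \<bullet> (y - z) = 0" using orth E y z subspace_diff by blast
    then have "(norm (x - z))\<^sup>2 = (norm (x - y))\<^sup>2 + (norm (y - z))\<^sup>2"
      using norm_add_Pythagorean[of "x - y" "y - z"] by (simp add: orthogonal_def)
    then have "(norm (x - y))\<^sup>2 \<le> (norm (x - z))\<^sup>2" by simp
    then show ?thesis by (simp add: dist_norm)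
  qed
  then show ?thesis
    using closest_point_unique[of E y x] E y closed_subspace subspace_imp_convex by metis
qed

lemma closest_point_subspace:
  fixes E :: "'a::euclidean_space set"
  assumes E: "subspace E"
  shows "closest_point E x \<in> E" and "z \<in> E \<Longrightarrow> (x - closest_point E x) \<bullet> z = 0"
proof -
  obtain y w where yw: "y \<in> span E" "\<And>z. z \<in> span E \<Longrightarrow> orthogonal w z" "x = y + w"
    using orthogonal_subspace_decomp_exists by blast
  moreover have "span E = E" using E by (simp add: span_eq_iff)
  ultimately have "closest_point E x = y"
    by (intro closest_point_subspaceI[OF E]) (auto simp: orthogonal_def)
  then show "closest_point E x \<in> E" "z \<in> E \<Longrightarrow> (x - closest_point E x) \<bullet> z = 0"
    using yw \<open>span E = E\<close> by (auto simp: orthogonal_def)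
qed

lemma linear_closest_point_subspace:
  fixes E :: "'a::euclidean_space set"
  assumes E: "subspace E"
  shows "linear (closest_point E)"
proof (rule linearI)
  fix x y :: 'a and r :: real
  note c = closest_point_subspace[OF E]
  show "closest_point E (x + y) = closest_point E x + closest_point E y"
  proof (rule closest_point_subspaceI[OF E])
    show "closest_point E x + closest_point E y \<in> E" using c E subspace_add by blast
    show "(x + y - (closest_point E x + closest_point E y)) \<bullet> z = 0" if "z \<in> E" for z
      using c(2)[OF that, of x] c(2)[OF that, of y] by (simp add: inner_simps)
  qed
  show "closest_point E (r *\<^sub>R x) = r *\<^sub>R closest_point E x"
  proof (rule closest_point_subspaceI[OF E])
    show "r *\<^sub>R closest_point E x \<in> E" using c E subspace_scale by blast
    show "(r *\<^sub>R x - r *\<^sub>R closest_point E x) \<bullet> z = 0" if "z \<in> E" for z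
      using c(2)[OF that, of x] by (simp add: inner_simps)
  qed
qed

lemma closest_point_span_insert:
  fixes a :: "'a::euclidean_space" and S :: "'a set"
  defines "u \<equiv> a - closest_point (span S) a"
  shows "closest_point (span (insert a S)) x
           = closest_point (span S) x + ((u \<bullet> x) / (u \<bullet> u)) *\<^sub>R u"
proof -
  note c = closest_point_subspace[OF subspace_span[of S]]
  let ?P = "closest_point (span S)"
  have uo: "u \<bullet> z = 0" if "z \<in> span S" for z
    using c(2)[OF that, of a] by (simp add: u_def)
  have uin: "u \<in> span (insert a S)"
    unfolding u_def using c(1) by (meson insertI1 span_base span_diff span_mono subset_iff subset_insertI)
  show ?thesis
  proof (rule closest_point_subspaceI[OF subspace_span])
    show "?P x + ((u \<bullet> x) / (u \<bullet> u)) *\<^sub>R u \<in> span (insert a S)"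
      using c(1) uin by (meson span_add span_mono span_scale subset_iff subset_insertI)
    fix z assume "z \<in> span (insert a S)"
    then obtain k where "z - k *\<^sub>R a \<in> span S" using span_breakdown_eq by blast
    then have s: "z - k *\<^sub>R u \<in> span S"
      using span_add[OF _ span_scale[OF c(1)[of a], of k]] unfolding u_def
      by (fastforce simp: algebra_simps)
    let ?s = "z - k *\<^sub>R u"
    have 1: "(x - ?P x) \<bullet> ?s = 0" using c(2)[OF s] .
    have 2: "u \<bullet> ?s = 0" using uo[OF s] .
    have 3: "?P x \<bullet> u = 0" using uo[OF c(1)[of x]] by (simp add: inner_commute)
    have "(x - (?P x + ((u \<bullet> x) / (u \<bullet> u)) *\<^sub>R u)) \<bullet> (?s + k *\<^sub>R u) = 0"
    proof -
      have "((u \<bullet> x) / (u \<bullet> u)) * (u \<bullet> u) = u \<bullet> x" by simp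
      moreover have "(x - (?P x + ((u \<bullet> x) / (u \<bullet> u)) *\<^sub>R u)) \<bullet> (?s + k *\<^sub>R u)
        = (x - ?P x) \<bullet> ?s - ((u \<bullet> x) / (u \<bullet> u)) * (u \<bullet> ?s)
          + k * (x \<bullet> u - ?P x \<bullet> u - ((u \<bullet> x) / (u \<bullet> u)) * (u \<bullet> u))"
        by (simp only: inner_diff_left inner_add_left inner_add_right inner_scaleR_left inner_scaleR_right algebra_simps)
      ultimately show ?thesis unfolding 1 2 3 by (simp add: inner_commute)
    qed
    then show "(x - (?P x + ((u \<bullet> x) / (u \<bullet> u)) *\<^sub>R u)) \<bullet> z = 0" by simp
  qed
qed

lemma matrix_closest_point_works:
  fixes E :: "(real^'n) set"
  shows "subspace E \<Longrightarrow> matrix (closest_point E) *v x = closest_point E x"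
  by (simp add: linear_closest_point_subspace matrix_works)

lemma borel_measurable_vec_lambda:
  fixes f :: "'i::finite \<Rightarrow> 'b \<Rightarrow> 'a::euclidean_space"
  assumes "\<And>i. f i \<in> borel_measurable M"
  shows "(\<lambda>w. \<chi> i. f i w) \<in> borel_measurable M"
proof (subst borel_measurable_euclidean_space, safe)
  fix b :: "'a^'i" assume "b \<in> Basis"
  then obtain i u where b: "b = axis i u" by (auto simp: Basis_vec_def)
  have "(\<lambda>w. (\<chi> i. f i w) \<bullet> b) = (\<lambda>w. f i w \<bullet> u)" by (simp add: b inner_axis)
  then show "(\<lambda>w. (\<chi> i. f i w) \<bullet> b) \<in> borel_measurable M" using assms by simp
qed

lemma borel_measurable_vec_nth:
  fixes f :: "'b \<Rightarrow> 'a::euclidean_space^'i"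
  assumes "f \<in> borel_measurable M"
  shows "(\<lambda>w. f w $ i) \<in> borel_measurable M"
  by (rule borel_measurable_continuous_on[OF _ assms]) (intro continuous_intros)

lemma borel_measurable_matrix_vector:
  fixes Q :: "'b \<Rightarrow> real^'n^'m"
  assumes "Q \<in> borel_measurable M" "v \<in> borel_measurable M"
  shows "(\<lambda>w. Q w *v v w) \<in> borel_measurable M"
proof -
  have "(\<lambda>w. Q w $ i $ k) \<in> borel_measurable M" "(\<lambda>w. v w $ k) \<in> borel_measurable M" for i k
    using assms by (simp_all add: borel_measurable_vec_nth)
  then show ?thesis unfolding matrix_vector_mult_def
    by (intro borel_measurable_vec_lambda borel_measurable_sum borel_measurable_times)
qed

lemma borel_measurable_span_projection:
  fixes v :: "nat \<Rightarrow> 'b \<Rightarrow> real^'n"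
  assumes "\<And>i. i < k \<Longrightarrow> v i \<in> borel_measurable M"
  shows "(\<lambda>w. matrix (closest_point (span ((\<lambda>i. v i w) ` {..<k})))) \<in> borel_measurable M"
  using assms
proof (induction k)
  case 0
  then show ?case by simp
next
  case (Suc k)
  define Q where "Q w = matrix (closest_point (span ((\<lambda>i. v i w) ` {..<k})))" for w
  have Q: "Q \<in> borel_measurable M" using Suc by (simp add: Q_def[abs_def])
  define u where "u w = v k w - Q w *v v k w" for w
  have u: "u \<in> borel_measurable M"
    unfolding u_def using Q Suc.prems by (intro borel_measurable_diff borel_measurable_matrix_vector) auto
  have uk: "(\<lambda>w. u w $ i) \<in> borel_measurable M" for i
    using u by (rule borel_measurable_vec_nth)
  have Qk: "(\<lambda>w. Q w $ r $ c) \<in> borel_measurable M" for r c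
    using Q by (simp add: borel_measurable_vec_nth)
  have "matrix (closest_point (span ((\<lambda>i. v i w) ` {..<Suc k})))
        = (\<chi> r c. Q w $ r $ c + u w $ r * u w $ c / (u w \<bullet> u w))" for w
  proof -
    let ?S = "(\<lambda>i. v i w) ` {..<k}"
    have uw: "u w = v k w - closest_point (span ?S) (v k w)"
      by (simp add: u_def Q_def matrix_closest_point_works)
    have "(\<lambda>i. v i w) ` {..<Suc k} = insert (v k w) ?S" by (simp add: lessThan_Suc)
    then have "closest_point (span ((\<lambda>i. v i w) ` {..<Suc k})) x
       = Q w *v x + ((u w \<bullet> x) / (u w \<bullet> u w)) *\<^sub>R u w" for x
      by (simp add: closest_point_span_insert uw[symmetric] Q_def matrix_closest_point_works)
    then show ?thesis
      unfolding matrix_def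
      by (simp add: vec_eq_iff matrix_vector_mul_component inner_axis)
  qed
  then show ?case
    using uk Qk u by (auto intro!: borel_measurable_vec_lambda)
qed


lemma orthogonal_transformation_rotation:
  fixes Q :: "real^'n^'n"
  assumes "rotation_matrix Q"
  shows "orthogonal_transformation ((*v) Q)"
  using assms by (simp add: rotation_matrix_def orthogonal_transformation_matrix)

lemma closest_point_orthogonal_image:
  fixes Q :: "real^'n^'n"
  assumes Q: "rotation_matrix Q" and E: "subspace E"
  shows "closest_point ((*v) Q ` E) x = Q *v closest_point E (transpose Q *v x)"
proof (rule closest_point_subspaceI)
  note c = closest_point_subspace[OF E]
  show "subspace ((*v) Q ` E)" using E by (simp add: linear_subspace_image)
  show "Q *v closest_point E (transpose Q *v x) \<in> (*v) Q ` E" using c by blast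
  have QQ: "Q ** transpose Q = mat 1" "transpose Q ** Q = mat 1"
    using Q by (auto simp: rotation_matrix_def orthogonal_matrix_def)
  fix z assume "z \<in> (*v) Q ` E"
  then obtain y where y: "y \<in> E" "z = Q *v y" by blast
  have "(x - Q *v closest_point E (transpose Q *v x)) \<bullet> z
        = (transpose Q *v (x - Q *v closest_point E (transpose Q *v x))) \<bullet> y"
    by (simp add: y dot_lmul_matrix[symmetric])
  also have "\<dots> = (transpose Q *v x - closest_point E (transpose Q *v x)) \<bullet> y"
    by (simp add: matrix_vector_mult_diff_distrib matrix_vector_mul_assoc QQ)
  also have "\<dots> = 0" using c(2)[OF y(1)] .
  finally show "(x - Q *v closest_point E (transpose Q *v x)) \<bullet> z = 0" .
qed

lemma rotation_image_grassmannian: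
  fixes Q :: "real^'n^'n"
  assumes Q: "rotation_matrix Q" and E: "E \<in> grassmannian j"
  shows "(*v) Q ` E \<in> grassmannian j"
proof -
  have "inj ((*v) Q)"
    using orthogonal_transformation_inj orthogonal_transformation_rotation[OF Q] by blast
  then have "dim ((*v) Q ` E) = dim E"
    by (intro dim_image_eq) (auto intro: inj_on_subset)
  then show ?thesis using E by (auto simp: grassmannian_def linear_subspace_image)
qed

lemma space_grassmann_borel [simp]: "space (grassmann_borel j) = grassmannian j"
  by (simp add: grassmann_borel_def)

lemma measurable_rotation_grassmann:
  fixes Q :: "real^'n^'n"
  assumes Q: "rotation_matrix Q"
  shows "(\<lambda>E. (*v) Q ` E) \<in> measurable (grassmann_borel j) (grassmann_borel j)"
  unfolding grassmann_borel_def[of j, THEN arg_cong, of "measurable (grassmann_borel j)"]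
proof (rule measurable_vimage_algebra2)
  show "(\<lambda>E. (*v) Q ` E) \<in> space (grassmann_borel j) \<rightarrow> grassmannian j"
    using rotation_image_grassmannian[OF Q] by auto
  have P: "(\<lambda>E. matrix (closest_point E)) \<in> measurable (grassmann_borel j) borel"
    unfolding grassmann_borel_def by (rule measurable_vimage_algebra1) auto
  have "(\<lambda>E. Q ** matrix (closest_point E) ** transpose Q) \<in> measurable (grassmann_borel j) borel"
    by (rule borel_measurable_continuous_on[OF _ P, where f="\<lambda>A. Q ** A ** transpose Q"])
       (auto simp: matrix_matrix_mult_def intro!: continuous_intros)
  moreover have "matrix (closest_point ((*v) Q ` E)) = Q ** matrix (closest_point E) ** transpose Q"
    if "E \<in> space (grassmann_borel j)" for E
  proof -
    have E: "subspace E" using that by (simp add: grassmannian_def)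
    have "subspace ((*v) Q ` E)" using E by (simp add: linear_subspace_image)
    then show ?thesis
      by (simp add: matrix_eq matrix_closest_point_works E closest_point_orthogonal_image[OF Q E]
          flip: matrix_vector_mul_assoc)
  qed
  ultimately show "(\<lambda>E. matrix (closest_point ((*v) Q ` E))) \<in> measurable (grassmann_borel j) borel"
    by (subst measurable_cong) auto
qed

lemma rotation_image_sets:
  fixes Q :: "real^'n^'n"
  assumes Q: "rotation_matrix Q" and A: "A \<in> sets (grassmann_borel j)"
  shows "(\<lambda>E. (*v) Q ` E) ` A \<in> sets (grassmann_borel j)"
proof -
  have Q': "rotation_matrix (transpose Q)"
    using Q by (simp add: rotation_matrix_def orthogonal_matrix_transpose)
  have QQ: "Q ** transpose Q = mat 1" "transpose Q ** Q = mat 1"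
    using Q by (auto simp: rotation_matrix_def orthogonal_matrix_def)
  have i: "(*v) Q ` (*v) (transpose Q) ` E = E" "(*v) (transpose Q) ` (*v) Q ` E = E" for E
    by (simp_all add: image_image matrix_vector_mul_assoc QQ del: transpose_matrix_vector)
  have AG: "A \<subseteq> grassmannian j" using sets.sets_into_space[OF A] by simp
  have "(\<lambda>E. (*v) Q ` E) ` A
      = (\<lambda>E. (*v) (transpose Q) ` E) -` A \<inter> space (grassmann_borel j)"
  proof (intro equalityI subsetI)
    fix F assume "F \<in> (\<lambda>E. (*v) Q ` E) ` A"
    then show "F \<in> (\<lambda>E. (*v) (transpose Q) ` E) -` A \<inter> space (grassmann_borel j)"
      using AG rotation_image_grassmannian[OF Q] i by auto
  next
    fix F assume "F \<in> (\<lambda>E. (*v) (transpose Q) ` E) -` A \<inter> space (grassmann_borel j)"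
    then have "(*v) (transpose Q) ` F \<in> A" by simp
    then show "F \<in> (\<lambda>E. (*v) Q ` E) ` A" using i(1)[of F] by (metis imageI)
  qed
  then show ?thesis using measurable_sets[OF measurable_rotation_grassmann[OF Q'] A] by simp
qed

lemma row_span_grassmannian:
  fixes V :: "real^'n^'n"
  assumes V: "det V \<noteq> 0" and h: "bij_betw h {..<CARD('n)} (UNIV :: 'n set)" and j: "j \<le> CARD('n)"
  shows "span ((\<lambda>i. V $ h i) ` {..<j}) \<in> grassmannian j"
proof -
  have inv: "invertible V" using V by (simp add: invertible_det_nz)
  have inj: "inj (\<lambda>i. V $ i)"
    using V det_identical_rows[of _ _ V] by (auto simp: inj_on_def row_def vec_eq_iff)
  have "independent (rows V)"
    using V det_dependent_rows[of V] by (auto simp: dependent_vec_eq)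
  then have ind: "independent ((\<lambda>i. V $ h i) ` {..<j})"
    by (rule independent_mono) (auto simp: rows_def row_def)
  have "inj_on (\<lambda>i. V $ h i) {..<j}"
    using inj h j by (auto simp: inj_on_def bij_betw_def) 
  then have "card ((\<lambda>i. V $ h i) ` {..<j}) = j" by (simp add: card_image)
  then show ?thesis using ind by (simp add: grassmannian_def dim_eq_card_independent)
qed

theorem ex_is_grassmann_haar:
  assumes j: "j \<le> CARD('n)"
  shows "\<exists>\<nu> :: (real^'n) set measure. is_grassmann_haar j \<nu>"
proof -
  obtain h where h: "bij_betw h {..<CARD('n)} (UNIV :: 'n set)"
    using ex_bij_betw_nat_finite[of "UNIV :: 'n set"] by (auto simp: atLeast0LessThan)
  define S :: "(real^'n^'n) set" where "S = {V. norm V < 1 \<and> det V \<noteq> 0}"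
  define R where "R V = span ((\<lambda>i. V $ h i) ` {..<j})" for V :: "real^'n^'n"
  define \<phi> where "\<phi> V = (if V \<in> S then R V else R (mat 1))" for V
  have cdet: "continuous_on UNIV (det :: real^'n^'n \<Rightarrow> real)"
    unfolding det_def[abs_def] by (intro continuous_intros)
  have "open (ball 0 1 \<inter> (det -` (- {0}) :: (real^'n^'n) set))"
    using cdet by (intro open_Int open_vimage) auto
  also have "ball 0 1 \<inter> (det -` (- {0}) :: (real^'n^'n) set) = S"
    by (auto simp: S_def)
  finally have openS: "open S" .
  define c where "c = 1 / (2 * norm (mat 1 :: real^'n^'n))"
  have n0: "norm (mat 1 :: real^'n^'n) > 0"
    by (auto simp: mat_def vec_eq_iff)
  have "c *\<^sub>R mat 1 \<in> S"
  proof -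
    have "det (c *\<^sub>R mat 1 :: real^'n^'n) = (\<Prod>i\<in>(UNIV::'n set). c)"
      by (subst det_diagonal) (auto simp: mat_def)
    then show ?thesis using n0 by (simp add: S_def c_def)
  qed
  then have ne: "S \<noteq> {}" by blast
  have Spos: "emeasure lborel S \<noteq> 0"
  proof
    assume "emeasure lborel S = 0"
    then have "S \<in> null_sets lebesgue" using openS by (intro null_setsI) auto
    then show False using open_not_negligible[OF openS ne] negligible_iff_null_sets by blast
  qed
  have Sfin: "emeasure lborel S \<noteq> \<infinity>"
  proof -
    have "emeasure lborel S \<le> emeasure lborel (cball (0::real^'n^'n) 1)"
      by (intro emeasure_mono) (auto simp: S_def)
    then show ?thesis using emeasure_lborel_cball_finite[of "0::real^'n^'n" 1] by auto
  qed
  have Sm [measurable]: "S \<in> sets borel" using openS by simp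
  have det1: "det (mat 1 :: real^'n^'n) \<noteq> 0" by simp
  have RG: "R V \<in> grassmannian j" if "det V \<noteq> 0" for V
    unfolding R_def by (rule row_span_grassmannian[OF that h j])
  have \<phi>G: "\<phi> V \<in> grassmannian j" for V
    using RG[of V] RG[OF det1] by (auto simp: \<phi>_def S_def)
  have \<phi>m: "\<phi> \<in> measurable borel (grassmann_borel j)"
    unfolding grassmann_borel_def
  proof (rule measurable_vimage_algebra2)
    show "\<phi> \<in> space borel \<rightarrow> grassmannian j" using \<phi>G by auto
    have 1: "(\<lambda>V. matrix (closest_point (R V))) \<in> borel_measurable borel"
      unfolding R_def
      by (rule borel_measurable_span_projection, rule borel_measurable_continuous_onI) (intro continuous_intros)
    have "(\<lambda>V. if V \<in> S then matrix (closest_point (R V)) else matrix (closest_point (R (mat 1))))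
          \<in> borel_measurable borel"
      using 1 by (intro measurable_If) auto
    then show "(\<lambda>V. matrix (closest_point (\<phi> V))) \<in> borel_measurable borel"
      by (simp add: \<phi>_def if_distrib[of closest_point] if_distrib[of matrix])
  qed
  define U where "U = uniform_measure lborel S"
  have \<phi>U: "\<phi> \<in> measurable U (grassmann_borel j)"
    using \<phi>m by (simp add: U_def)
  define \<nu> where "\<nu> = distr U (grassmann_borel j) \<phi>"
  have em: "emeasure \<nu> A = emeasure lborel (S \<inter> \<phi> -` A) / emeasure lborel S"
    if "A \<in> sets (grassmann_borel j)" for A
  proof -
    have "\<phi> -` A \<in> sets borel" using measurable_sets[OF \<phi>m that] by simp
    then show ?thesis
      using that \<phi>U by (simp add: \<nu>_def emeasure_distr U_def)
  qed
  have "is_grassmann_haar j \<nu>"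
    unfolding is_grassmann_haar_def
  proof (intro conjI allI impI ballI)
    show "sets \<nu> = sets (grassmann_borel j)" by (simp add: \<nu>_def)
    have "S \<inter> \<phi> -` grassmannian j = S" using \<phi>G by auto
    then have "emeasure \<nu> (grassmannian j) = 1"
      using em[of "grassmannian j"] sets.top[of "grassmann_borel j"] Spos Sfin
      by (simp add: ennreal_divide_self top.not_eq_extremum)
    then show "emeasure \<nu> (space \<nu>) = 1" by (simp add: \<nu>_def)
    fix Q :: "real^'n^'n" and A assume Q: "rotation_matrix Q" and "A \<in> sets \<nu>"
    then have A: "A \<in> sets (grassmann_borel j)" by (simp add: \<nu>_def)
    have QA: "(\<lambda>E. (*v) Q ` E) ` A \<in> sets (grassmann_borel j)"
      by (rule rotation_image_sets[OF Q A])
    have QQ: "Q ** transpose Q = mat 1" "transpose Q ** Q = mat 1"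
      using Q by (auto simp: rotation_matrix_def orthogonal_matrix_def)
    define T where "T V = (\<chi> i. Q *v (V $ i))" for V :: "real^'n^'n"
    have TV: "T V = V ** transpose Q" for V
      by (simp add: T_def vec_eq_iff matrix_matrix_mult_def matrix_vector_mult_def transpose_def mult.commute)
    have T: "orthogonal_transformation T"
      unfolding orthogonal_transformation_def
    proof (intro conjI allI)
      show "linear T"
        by (rule linearI) (simp_all add: T_def vec_eq_iff matrix_vector_right_distrib matrix_vector_mult_scaleR)
      show "T v \<bullet> T w = v \<bullet> w" for v w
        using orthogonal_transformation_rotation[OF Q]
        by (simp add: T_def inner_vec_def[of "\<chi> i. Q *v v $ i"] inner_vec_def[of v] orthogonal_transformation_def)
    qed
    have TS: "T V \<in> S \<longleftrightarrow> V \<in> S" for V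
      using orthogonal_transformation_norm[OF T, of V] Q
      by (simp add: S_def TV det_mul det_transpose rotation_matrix_def)
    have RT: "R (T V) = (*v) Q ` R V" for V
      by (simp add: R_def T_def linear_span_image image_image flip: span_linear_image)
    have \<phi>T: "\<phi> (T V) = (*v) Q ` \<phi> V" if "V \<in> S" for V
      using that TS RT by (simp add: \<phi>_def)
    have injQ: "(*v) Q ` E = (*v) Q ` F \<longleftrightarrow> E = F" for E F
      using orthogonal_transformation_inj[OF orthogonal_transformation_rotation[OF Q]]
      by (simp add: inj_image_eq_iff)
    have surjT: "surj T" using orthogonal_transformation_surj[OF T] .
    have eq: "S \<inter> \<phi> -` ((\<lambda>E. (*v) Q ` E) ` A) = T ` (S \<inter> \<phi> -` A)"
    proof (intro equalityI subsetI)
      fix W assume W: "W \<in> S \<inter> \<phi> -` ((\<lambda>E. (*v) Q ` E) ` A)"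
      obtain V where V: "W = T V" using surjT by blast
      then have VS: "V \<in> S" using W TS by blast
      then have "(*v) Q ` \<phi> V \<in> (\<lambda>E. (*v) Q ` E) ` A" using W V \<phi>T by auto
      then obtain F where "F \<in> A" "(*v) Q ` \<phi> V = (*v) Q ` F" by (rule imageE)
      then have "\<phi> V \<in> A" using injQ by simp
      then show "W \<in> T ` (S \<inter> \<phi> -` A)" using V VS by blast
    next
      fix W assume "W \<in> T ` (S \<inter> \<phi> -` A)"
      then show "W \<in> S \<inter> \<phi> -` ((\<lambda>E. (*v) Q ` E) ` A)" using TS \<phi>T by auto
    qed
    have "S \<inter> \<phi> -` ((\<lambda>E. (*v) Q ` E) ` A) \<in> sets borel"
      using measurable_sets[OF \<phi>m QA] by auto
    then have "emeasure lborel (S \<inter> \<phi> -` ((\<lambda>E. (*v) Q ` E) ` A)) = emeasure lborel (S \<inter> \<phi> -` A)"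
      using lborel_orthogonal_image[OF T] by (simp add: eq)
    then show "emeasure \<nu> ((\<lambda>E. (*v) Q ` E) ` A) = emeasure \<nu> A"
      using em[OF A] em[OF QA] by simp
  qed
  then show ?thesis ..
qed

lemma is_grassmann_haar_grassmann_haar:
  "j \<le> CARD('n) \<Longrightarrow> is_grassmann_haar j (grassmann_haar j :: (real^'n) set measure)"
  unfolding grassmann_haar_def by (rule someI_ex) (rule ex_is_grassmann_haar)

end

theory Submission
  imports Defs "HOL-Probability.Distributions"
begin

text \<open>Since \<open>\<Pi>\<^sub>E\<close> is superadditive, log-convexity is Hoelder's inequality for the measure
  \<open>d\<nu>\<^sub>j(E) dy\<close>. Equality makes the integrands proportional, and the value at \<open>0\<close> shows that they are
  equal: for almost every \<open>E\<close>, \<open>\<Pi>\<^sub>E f = \<Pi>\<^sub>E g\<close> and \<open>\<Pi>\<^sub>E h = \<lambda> \<Pi>\<^sub>E f + (1 - \<lambda>) \<Pi>\<^sub>E g\<close>, where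
  \<open>h = \<lambda> f + (1 - \<lambda>) g\<close> (respectively \<open>f = g\<close> on \<open>E\<close>). Such \<open>E\<close> have a dense union, which settles the
  dual case. For the projections, convexity is not available, so \<open>\<Pi>\<^sub>E f = \<Pi>\<^sub>E g\<close> alone does
  not give \<open>f = g\<close>; but every \<open>v\<close> in such an \<open>E\<close> is the gradient of \<open>h\<close> at a minimiser on a
  hyperplane with normal \<open>v\<close>, and \<open>f = g\<close> at that minimiser. Hence \<open>\<nabla>h\<close>, being a proper map,
  maps the zero set of \<open>f - g\<close> onto all nonzero vectors, which is impossible unless \<open>f = g\<close>, because the
  zero set of a nonzero polynomial is negligible.\<close>

section \<open>Gaussian weights\<close>

text \<open>A product of identical factors does not depend on the names of its coordinates. This
  moves coordinates from \<open>Basis\<close>, on which \<open>lborel\<close> is built, to another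
  orthonormal basis.\<close>

lemma distr_PiM_lborel_reindex:
  assumes \<sigma>: "bij_betw \<sigma> S I" and fin: "finite I"
  shows "distr (\<Pi>\<^sub>M i\<in>I. (lborel :: real measure)) (\<Pi>\<^sub>M s\<in>S. lborel) (\<lambda>c. \<lambda>s\<in>S. c (\<sigma> s))
           = (\<Pi>\<^sub>M s\<in>S. lborel)"
proof -
  interpret product_sigma_finite "\<lambda>_. lborel :: real measure" by standard
  have finS: "finite S" using \<sigma> fin bij_betw_finite by blast
  have \<sigma>I: "\<sigma> s \<in> I" if "s \<in> S" for s using \<sigma> that by (auto simp: bij_betw_def)
  have inj: "inj_on \<sigma> S" and im: "\<sigma> ` S = I" using \<sigma> by (auto simp: bij_betw_def)
  have m: "(\<lambda>c. \<lambda>s\<in>S. c (\<sigma> s)) \<in> measurable (\<Pi>\<^sub>M i\<in>I. (lborel :: real measure)) (\<Pi>\<^sub>M s\<in>S. lborel)"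
    by (rule measurable_restrict) (rule measurable_component_singleton[OF \<sigma>I])
  show ?thesis
  proof (rule PiM_eqI[OF finS])
    fix A :: "_ \<Rightarrow> real set" assume A: "\<And>s. s \<in> S \<Longrightarrow> A s \<in> sets lborel"
    \<comment> \<open>The box transported along \<sigma>, so that the preimage of a box is again a
      box with the same side lengths.\<close>
    define A' where "A' i = A (inv_into S \<sigma> i)" for i
    have A'\<sigma>: "A' (\<sigma> s) = A s" if "s \<in> S" for s using inj that by (simp add: A'_def)
    have "(\<lambda>c. \<lambda>s\<in>S. c (\<sigma> s)) -` Pi\<^sub>E S A \<inter> space (\<Pi>\<^sub>M i\<in>I. (lborel :: real measure)) = Pi\<^sub>E I A'"
      unfolding im[symmetric] by (auto simp: space_PiM PiE_iff A'\<sigma>)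
    moreover have "Pi\<^sub>E S A \<in> sets (\<Pi>\<^sub>M s\<in>S. lborel)" using A finS by (intro sets_PiM_I_finite) auto
    ultimately have "emeasure (distr (\<Pi>\<^sub>M i\<in>I. lborel) (\<Pi>\<^sub>M s\<in>S. lborel) (\<lambda>c. \<lambda>s\<in>S. c (\<sigma> s))) (Pi\<^sub>E S A)
        = emeasure (\<Pi>\<^sub>M i\<in>I. lborel) (Pi\<^sub>E I A')"
      using m by (simp add: emeasure_distr)
    also have "\<dots> = (\<Prod>i\<in>\<sigma> ` S. emeasure lborel (A' i))"
      unfolding im using A A'\<sigma> im by (intro emeasure_PiM fin) force
    also have "\<dots> = (\<Prod>s\<in>S. emeasure lborel (A s))"
      using inj A'\<sigma> by (simp add: prod.reindex)
    finally show "emeasure (distr (\<Pi>\<^sub>M i\<in>I. lborel) (\<Pi>\<^sub>M s\<in>S. lborel) (\<lambda>c. \<lambda>s\<in>S. c (\<sigma> s))) (Pi\<^sub>E S A)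
        = (\<Prod>s\<in>S. emeasure lborel (A s))" .
  qed simp
qed

lemma orthonormal_basis_of_imp_independent: "orthonormal_basis_of E B \<Longrightarrow> independent B"
  unfolding orthonormal_basis_of_def
  by (intro pairwise_orthogonal_independent) (metis norm_zero zero_neq_one)+

text \<open>An orthogonal map carries \<open>Basis\<close> onto \<open>S\<close>, and
  \<open>lborel\<close> is invariant under it; what remains is a renaming of coordinates. This
  allows coordinates adapted to a subspace and its orthogonal complement.\<close>

lemma lborel_orthonormal_basis:
  fixes S :: "'a::euclidean_space set"
  assumes S: "orthonormal_basis_of UNIV S"
  shows "lborel = distr (\<Pi>\<^sub>M b\<in>S. lborel) borel (\<lambda>c. \<Sum>b\<in>S. c b *\<^sub>R b)"
proof -
  have orth: "pairwise orthogonal S" "\<And>b. b \<in> S \<Longrightarrow> norm b = 1" "span S = UNIV"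
    using S by (auto simp: orthonormal_basis_of_def)
  have ind: "independent S" using S by (rule orthonormal_basis_of_imp_independent)
  then have finS: "finite S" using independent_imp_finite by blast
  have "card S = DIM('a)" using ind orth(3) by (metis dim_UNIV dim_span_eq_card_independent)
  then obtain \<tau> :: "'a \<Rightarrow> 'a" where \<tau>: "bij_betw \<tau> S Basis"
    using finS finite_same_card_bij[of S "Basis :: 'a set"] by auto
  \<comment> \<open>The linear map with \<open>T (\<tau> b) = b\<close>; it is orthogonal because it
    takes one orthonormal basis to another.\<close>
  define T where "T x = (\<Sum>b\<in>S. (x \<bullet> \<tau> b) *\<^sub>R b)" for x :: 'a
  have bb: "b \<bullet> b' = (if b = b' then 1 else 0)" if "b \<in> S" "b' \<in> S" for b b'
    using orth(1,2) that by (auto simp: pairwise_def orthogonal_def norm_eq_1)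
  have T: "orthogonal_transformation T"
    unfolding orthogonal_transformation_def
  proof (intro conjI allI)
    show "linear T"
      by (rule linearI) (simp_all add: T_def inner_simps scaleR_left_distrib sum.distrib scaleR_sum_right)
    fix v w
    have "T v \<bullet> T w = (\<Sum>b\<in>S. \<Sum>b'\<in>S. (v \<bullet> \<tau> b) * (w \<bullet> \<tau> b') * (b \<bullet> b'))"
      by (subst sum.swap) (simp add: T_def inner_sum_left inner_sum_right sum_distrib_left mult_ac)
    also have "\<dots> = (\<Sum>b\<in>S. \<Sum>b'\<in>S. if b = b' then (v \<bullet> \<tau> b) * (w \<bullet> \<tau> b') else 0)"
      using bb by (intro sum.cong refl) auto
    also have "\<dots> = (\<Sum>b\<in>S. (v \<bullet> \<tau> b) * (w \<bullet> \<tau> b))"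
      using finS by simp
    also have "\<dots> = (\<Sum>b\<in>Basis. (v \<bullet> b) * (w \<bullet> b))"
      using sum.reindex_bij_betw[OF \<tau>, of "\<lambda>b. (v \<bullet> b) * (w \<bullet> b)"] .
    finally show "T v \<bullet> T w = v \<bullet> w" by (simp add: euclidean_inner[of v w])
  qed
  have Tm[measurable]: "T \<in> borel_measurable borel"
    unfolding T_def by measurable
  have "lborel = distr lborel borel T" by (rule lborel_orthogonal[OF T, symmetric])
  also have "\<dots> = distr (\<Pi>\<^sub>M b\<in>Basis. lborel) borel (\<lambda>c. T (\<Sum>b\<in>Basis. c b *\<^sub>R b))"
    by (subst lborel_eq) (simp add: distr_distr comp_def)
  also have "\<dots> = distr (\<Pi>\<^sub>M b\<in>Basis. lborel) borel (\<lambda>c. \<Sum>b\<in>S. (\<lambda>s\<in>S. c (\<tau> s)) b *\<^sub>R b)"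
  proof (intro distr_cong refl)
    fix c :: "'a \<Rightarrow> real"
    have "(\<Sum>b\<in>Basis. c b *\<^sub>R b) \<bullet> \<tau> b = c (\<tau> b)" if "b \<in> S" for b
    proof -
      have "\<tau> b \<in> Basis" using \<tau> that by (auto simp: bij_betw_def)
      then show ?thesis by (simp add: inner_sum_left_Basis)
    qed
    then show "T (\<Sum>b\<in>Basis. c b *\<^sub>R b) = (\<Sum>b\<in>S. (\<lambda>s\<in>S. c (\<tau> s)) b *\<^sub>R b)"
      by (simp add: T_def)
  qed
  also have "\<dots> = distr (distr (\<Pi>\<^sub>M b\<in>Basis. lborel) (\<Pi>\<^sub>M b\<in>S. lborel) (\<lambda>c. \<lambda>s\<in>S. c (\<tau> s)))
       borel (\<lambda>c. \<Sum>b\<in>S. c b *\<^sub>R b)"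
  proof (subst distr_distr)
    show "(\<lambda>c. \<lambda>s\<in>S. c (\<tau> s)) \<in> (\<Pi>\<^sub>M b\<in>Basis. lborel) \<rightarrow>\<^sub>M (\<Pi>\<^sub>M b\<in>S. lborel :: real measure)"
      using \<tau> by (intro measurable_restrict measurable_component_singleton) (auto simp: bij_betw_def)
  qed (simp_all add: comp_def)
  finally show ?thesis
    using distr_PiM_lborel_reindex[OF \<tau>] by simp
qed

lemma nn_integral_exp_minus_mult_square:
  assumes c: "c > 0"
  shows "(\<integral>\<^sup>+t. ennreal (exp (- (c * t\<^sup>2))) \<partial>lborel) = ennreal (sqrt (pi / c))"
proof -
  \<comment> \<open>The integrand is a multiple of the centred normal density of variance
    \<open>1 / (2 * c)\<close>, which has total mass 1.\<close>
  have eq: "exp (- (c * t\<^sup>2)) = sqrt (pi / c) * normal_density 0 (1 / sqrt (2 * c)) t" for t :: real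
    using c by (simp add: normal_density_def power_divide)
  have "(\<integral>\<^sup>+t. ennreal (exp (- (c * t\<^sup>2))) \<partial>lborel)
      = ennreal (\<integral>t. sqrt (pi / c) * normal_density 0 (1 / sqrt (2 * c)) t \<partial>lborel)"
    unfolding eq using c by (intro nn_integral_eq_integral integrable_mult_right) auto
  then show ?thesis using c by simp
qed

lemma nn_integral_exp_minus_norm_square_finite:
  assumes c: "c > 0"
  shows "(\<integral>\<^sup>+x. ennreal (exp (- (c * (norm x)\<^sup>2))) \<partial>(lborel :: 'a::euclidean_space measure)) < \<infinity>"
proof -
  have "exp (- (c * (norm x)\<^sup>2)) = (\<Prod>b\<in>Basis. exp (- (c * (x \<bullet> b)\<^sup>2)))" for x :: 'a
  proof -
    have "(norm x)\<^sup>2 = (\<Sum>b\<in>Basis. (x \<bullet> b)\<^sup>2)"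
      unfolding power2_norm_eq_inner by (subst euclidean_inner) (simp add: power2_eq_square)
    then show ?thesis by (simp add: exp_sum sum_distrib_left flip: sum_negf)
  qed
  then have "(\<integral>\<^sup>+x. ennreal (exp (- (c * (norm x)\<^sup>2))) \<partial>(lborel :: 'a measure))
      = (\<integral>\<^sup>+x. (\<Prod>b\<in>Basis. ennreal (exp (- (c * (x \<bullet> b)\<^sup>2)))) \<partial>(lborel :: 'a measure))"
    by (simp add: prod_ennreal)
  also have "\<dots> = ennreal (sqrt (pi / c)) ^ DIM('a)"
    by (subst nn_integral_lborel_prod) (simp_all add: nn_integral_exp_minus_mult_square[OF c])
  also have "\<dots> < \<infinity>" using c by (simp add: ennreal_power)
  finally show ?thesis .
qed

lemma orthonormal_basis_subspace_lborel:
  fixes E :: "'a::euclidean_space set"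
  assumes "subspace E"
  obtains B where "orthonormal_basis_of E B"
    "subspace_lborel E = distr (\<Pi>\<^sub>M b\<in>B. lborel) borel (\<lambda>c. \<Sum>b\<in>B. c b *\<^sub>R b)"
  using someI_ex[OF ex_orthonormal_basis_of[OF assms]] that by (simp add: subspace_lborel_def Let_def)

text \<open>A Gaussian weight in the directions orthogonal to \<open>E\<close> turns integrals over the varying
  subspace \<open>E\<close> into integrals over the whole space; the constant depends only on the dimension.\<close>

lemma nn_integral_subspace_lborel:
  fixes E :: "'a::euclidean_space set" and \<phi> :: "'a \<Rightarrow> ennreal"
  assumes E: "subspace E" and \<phi>[measurable]: "\<phi> \<in> borel_measurable borel"
  shows "(\<integral>\<^sup>+x. \<phi> (closest_point E x) * ennreal (exp (- (norm (x - closest_point E x))\<^sup>2)) \<partial>lborel)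
       = (\<integral>\<^sup>+y. \<phi> y \<partial>subspace_lborel E) * ennreal (sqrt pi) ^ (DIM('a) - dim E)"
proof -
  interpret product_sigma_finite "\<lambda>_. lborel :: real measure" by standard
  obtain B where B: "orthonormal_basis_of E B"
    and sB: "subspace_lborel E = distr (\<Pi>\<^sub>M b\<in>B. lborel) borel (\<lambda>c. \<Sum>b\<in>B. c b *\<^sub>R b)"
    using orthonormal_basis_subspace_lborel[OF E] .
  obtain C where C: "orthonormal_basis_of (E\<^sup>\<bottom>) C"
    using ex_orthonormal_basis_of[OF subspace_orthogonal_comp] by blast
  have Bo: "pairwise orthogonal B" "\<And>b. b \<in> B \<Longrightarrow> norm b = 1" "span B = E" "B \<subseteq> E"
    and Co: "pairwise orthogonal C" "\<And>b. b \<in> C \<Longrightarrow> norm b = 1" "span C = E\<^sup>\<bottom>" "C \<subseteq> E\<^sup>\<bottom>"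
    using B C by (auto simp: orthonormal_basis_of_def)
  have BC: "b \<bullet> c = 0" "c \<bullet> b = 0" if "b \<in> B" "c \<in> C" for b c
  proof -
    have "b \<in> E" "c \<in> E\<^sup>\<bottom>" using that Bo(4) Co(4) by auto
    then show "b \<bullet> c = 0" "c \<bullet> b = 0" by (simp_all add: orthogonal_comp_def orthogonal_def inner_commute)
  qed
  have disj: "B \<inter> C = {}"
  proof -
    have False if "b \<in> B" "b \<in> C" for b
      using BC(1)[OF that] Bo(2)[OF that(1)] by (simp add: norm_eq_1)
    then show ?thesis by blast
  qed
  have "x \<in> span (B \<union> C)" for x
  proof -
    have "closest_point E x \<in> span B" using closest_point_subspace(1)[OF E] Bo(3) by simp
    moreover have "x - closest_point E x \<in> span C"
      using closest_point_subspace(2)[OF E, of _ x] Co(3)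
      by (simp add: orthogonal_comp_def orthogonal_def inner_commute)
    ultimately have "closest_point E x + (x - closest_point E x) \<in> span (B \<union> C)"
      by (intro span_add) (meson span_mono sup_ge1 sup_ge2 subsetD)+
    then show ?thesis by simp
  qed
  \<comment> \<open>Orthonormal bases of \<open>E\<close> and of its complement combine to one of
    the whole space, so \<open>lborel\<close> becomes a product of a \<open>B\<close>-block and a
    \<open>C\<close>-block.\<close>
  then have BCo: "orthonormal_basis_of UNIV (B \<union> C)"
    using Bo Co BC by (auto simp: orthonormal_basis_of_def pairwise_def orthogonal_def)
  have indB: "independent B" and ind: "independent (B \<union> C)"
    using B BCo orthonormal_basis_of_imp_independent by blast+
  have fin: "finite B" "finite C" using independent_imp_finite[OF ind] by auto
  have "card B = dim E" using indB Bo(3) by (metis dim_span_eq_card_independent)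
  moreover have "card (B \<union> C) = DIM('a)"
    using ind BCo by (metis dim_UNIV dim_span_eq_card_independent orthonormal_basis_of_def)
  ultimately have cardC: "card C = DIM('a) - dim E"
    using disj fin by (simp add: card_Un_disjoint)
  define s where "s D c = (\<Sum>b\<in>D. c b *\<^sub>R b)" for D and c :: "'a \<Rightarrow> real"
  have sBE: "s B c \<in> E" for c
    using Bo(4) E by (auto simp: s_def intro!: subspace_sum subspace_scale)
  have sCE: "s C c \<bullet> z = 0" if "z \<in> E" for c z
  proof -
    have "b \<bullet> z = 0" if "b \<in> C" for b
      using Co(4) that \<open>z \<in> E\<close> by (auto simp: orthogonal_comp_def orthogonal_def inner_commute)
    then show ?thesis by (simp add: s_def inner_sum_left)
  qed
  have cp: "closest_point E (s B b + s C c) = s B b" for b c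
    using sBE sCE by (intro closest_point_subspaceI[OF E]) auto
  have nC: "(norm (s C c))\<^sup>2 = (\<Sum>b\<in>C. (c b)\<^sup>2)" for c
    using norm_sum_Pythagorean[OF fin(2), of "\<lambda>b. c b *\<^sub>R b"] Co(1,2)
    by (simp add: s_def pairwise_def orthogonal_def)
  have sm: "s (B \<union> C) (merge B C (b, c)) = s B b + s C c" for b c
    using disj fin by (simp add: s_def sum.union_disjoint)
  have cpm[measurable]: "closest_point E \<in> borel_measurable borel"
    using linear_closest_point_subspace[OF E] by (intro borel_measurable_continuous_onI linear_continuous_on)
      (simp add: linear_conv_bounded_linear)
  have smeas[measurable]: "s D \<in> borel_measurable (\<Pi>\<^sub>M b\<in>D. lborel)" for D
    unfolding s_def by measurable
  let ?h = "\<lambda>x. \<phi> (closest_point E x) * ennreal (exp (- (norm (x - closest_point E x))\<^sup>2))"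
  have "(\<integral>\<^sup>+x. ?h x \<partial>lborel) = (\<integral>\<^sup>+c. ?h (s (B \<union> C) c) \<partial>(\<Pi>\<^sub>M b\<in>B \<union> C. lborel))"
    by (subst lborel_orthonormal_basis[OF BCo]) (simp add: nn_integral_distr s_def)
  also have "\<dots> = (\<integral>\<^sup>+b. \<integral>\<^sup>+c. ?h (s (B \<union> C) (merge B C (b, c))) \<partial>(\<Pi>\<^sub>M b\<in>C. lborel) \<partial>(\<Pi>\<^sub>M b\<in>B. lborel))"
    by (rule product_nn_integral_fold[OF disj fin]) simp
  \<comment> \<open>Now \<phi> sees only the \<open>B\<close>-block, and the Gaussian only the
    \<open>C\<close>-block, where it is a product over the coordinates. Each coordinate in
    \<open>C\<close> then contributes a factor \<open>sqrt pi\<close>.\<close>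
  also have "\<dots> = (\<integral>\<^sup>+b. \<integral>\<^sup>+c. \<phi> (s B b) * (\<Prod>i\<in>C. ennreal (exp (- (c i)\<^sup>2)))
                    \<partial>(\<Pi>\<^sub>M b\<in>C. lborel) \<partial>(\<Pi>\<^sub>M b\<in>B. lborel))"
    by (simp add: sm cp nC exp_sum fin prod_ennreal flip: sum_negf)
  also have "\<dots> = (\<integral>\<^sup>+b. \<phi> (s B b) * ennreal (sqrt pi) ^ card C \<partial>(\<Pi>\<^sub>M b\<in>B. lborel))"
    by (subst nn_integral_cmult) (simp_all add: product_nn_integral_prod[OF fin(2), of "\<lambda>_ t. ennreal (exp (- t\<^sup>2))"]
        nn_integral_exp_minus_mult_square[of 1, simplified])
  also have "\<dots> = (\<integral>\<^sup>+y. \<phi> y \<partial>subspace_lborel E) * ennreal (sqrt pi) ^ card C"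
    by (subst nn_integral_multc) (simp_all add: sB nn_integral_distr s_def[symmetric])
  finally show ?thesis by (simp add: cardC)
qed

section \<open>The equality case of Hoelder's inequality\<close>

text \<open>The tangent of \<open>exp\<close> at the weighted mean \<open>t\<close> lies below the
  graph, strictly so away from \<open>t\<close>, and averaging its values at \<open>u\<close> and
  \<open>v\<close> gives \<open>exp t\<close>. Since \<open>s\<close> may lie below the mean,
  equality yields two facts: \<open>u\<close> and \<open>v\<close> coincide, and \<open>s\<close> is
  the mean.\<close>

lemma weighted_exp_convexity:
  fixes l s u v :: real
  assumes l: "0 < l" "l < 1" and s: "s \<le> l * u + (1 - l) * v"
  shows "exp s \<le> l * exp u + (1 - l) * exp v"
    and "exp s = l * exp u + (1 - l) * exp v \<Longrightarrow> u = v \<and> s = l * u + (1 - l) * v"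
proof -
  define t where "t = l * u + (1 - l) * v"
  have ge: "exp t * (1 + (w - t)) \<le> exp w" for w
    using mult_left_mono[OF exp_ge_add_one_self[of "w - t"], of "exp t"] by (simp flip: exp_add)
  have gr: "exp t * (1 + (w - t)) < exp w" if "w \<noteq> t" for w
  proof -
    have "1 + (w - t) \<noteq> exp (w - t)"
      using ln_eq_minus_one[of "exp (w - t)"] that by auto
    then have "1 + (w - t) < exp (w - t)" using exp_ge_add_one_self[of "w - t"] by linarith
    then have "exp t * (1 + (w - t)) < exp t * exp (w - t)" by simp
    then show ?thesis by (simp flip: exp_add)
  qed
  have t: "l * (exp t * (1 + (u - t))) + (1 - l) * (exp t * (1 + (v - t))) = exp t"
  proof -
    have "l * (exp t * (1 + (u - t))) + (1 - l) * (exp t * (1 + (v - t)))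
        = exp t * (1 + (l * u + (1 - l) * v - t))" by (simp add: algebra_simps)
    then show ?thesis by (simp add: t_def)
  qed
  have st: "exp s \<le> exp t" using s by (simp add: t_def)
  have lu: "l * (exp t * (1 + (u - t))) \<le> l * exp u" "(1 - l) * (exp t * (1 + (v - t))) \<le> (1 - l) * exp v"
    using l ge by (intro mult_left_mono; simp)+
  show "exp s \<le> l * exp u + (1 - l) * exp v" using st lu t by linarith
  assume eq: "exp s = l * exp u + (1 - l) * exp v"
  have "u = t"
  proof (rule ccontr)
    assume "u \<noteq> t"
    then have "l * (exp t * (1 + (u - t))) < l * exp u" using l gr by simp
    then show False using eq st lu t by linarith
  qed
  moreover have "v = t"
  proof (rule ccontr)
    assume "v \<noteq> t"
    then have "(1 - l) * (exp t * (1 + (v - t))) < (1 - l) * exp v" using l gr by simp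
    then show False using eq st lu t by linarith
  qed
  moreover have "exp s = exp t" using eq st lu t by linarith
  ultimately show "u = v \<and> s = l * u + (1 - l) * v" unfolding t_def[symmetric] by simp
qed

lemma integral_exp_pos:
  fixes p :: "'a \<Rightarrow> real"
  assumes p: "integrable M (\<lambda>x. exp (p x))" and M: "emeasure M (space M) \<noteq> 0"
  shows "0 < (\<integral>x. exp (p x) \<partial>M)"
proof -
  have "(\<integral>x. exp (p x) \<partial>M) \<noteq> 0"
  proof
    assume "(\<integral>x. exp (p x) \<partial>M) = 0"
    then have "AE x in M. False" using integral_nonneg_eq_0_iff_AE[OF p] by simp
    then show False using M by (auto simp: AE_iff_null null_sets_def)
  qed
  then show ?thesis by (simp add: less_le)
qed

text \<open>Subtracting the logarithms of the integrals normalises \<open>exp p\<close> and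
  \<open>exp q\<close> to integral 1; the pointwise convexity of \<open>exp\<close> is then
  integrated. Only an upper bound on \<open>r\<close> is assumed because projection is merely
  superadditive, and equality returns the identity for \<open>r\<close> as well.\<close>

lemma strict_Holder_or_proportional:
  fixes p q r :: "'a \<Rightarrow> real"
  assumes l: "0 < l" "l < 1"
    and p: "integrable M (\<lambda>x. exp (p x))" and q: "integrable M (\<lambda>x. exp (q x))"
    and r: "integrable M (\<lambda>x. exp (r x))"
    and M: "emeasure M (space M) \<noteq> 0"
    and le: "\<And>x. x \<in> space M \<Longrightarrow> r x \<le> l * p x + (1 - l) * q x"
  shows "(\<integral>x. exp (r x) \<partial>M) < (\<integral>x. exp (p x) \<partial>M) powr l * (\<integral>x. exp (q x) \<partial>M) powr (1 - l)
       \<or> (\<exists>c. AE x in M. p x - q x = c \<and> r x = l * p x + (1 - l) * q x)"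
proof -
  define \<alpha> where "\<alpha> = ln (\<integral>x. exp (p x) \<partial>M)"
  define \<beta> where "\<beta> = ln (\<integral>x. exp (q x) \<partial>M)"
  define m where "m = l * \<alpha> + (1 - l) * \<beta>"
  have e: "exp \<alpha> = (\<integral>x. exp (p x) \<partial>M)" "exp \<beta> = (\<integral>x. exp (q x) \<partial>M)"
    using integral_exp_pos[OF p M] integral_exp_pos[OF q M] by (simp_all add: \<alpha>_def \<beta>_def)
  have em: "(\<integral>x. exp (p x) \<partial>M) powr l * (\<integral>x. exp (q x) \<partial>M) powr (1 - l) = exp m"
    by (simp add: m_def exp_add powr_def flip: e)
  \<comment> \<open>The gap in the normalised pointwise inequality. It is nonnegative, and its
    integral is at most 0 when the strict inequality fails, so it then vanishes almost
    everywhere.\<close>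
  define D where "D x = l * exp (p x - \<alpha>) + (1 - l) * exp (q x - \<beta>) - exp (r x - m)" for x
  have le': "r x - m \<le> l * (p x - \<alpha>) + (1 - l) * (q x - \<beta>)" if "x \<in> space M" for x
    using le[OF that] by (simp add: m_def algebra_simps)
  have intD: "integrable M D"
    unfolding D_def exp_diff using p q r by auto
  have "(\<integral>x. D x \<partial>M) = l * (exp \<alpha> / exp \<alpha>) + (1 - l) * (exp \<beta> / exp \<beta>) - (\<integral>x. exp (r x) \<partial>M) / exp m"
    unfolding D_def exp_diff using p q r by (simp add: e)
  then have iD: "(\<integral>x. D x \<partial>M) = 1 - (\<integral>x. exp (r x) \<partial>M) / exp m" by simp
  have D0: "AE x in M. 0 \<le> D x"
    using weighted_exp_convexity(1)[OF l le'] by (auto simp: D_def)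
  have "\<exists>c. AE x in M. p x - q x = c \<and> r x = l * p x + (1 - l) * q x"
    if "\<not> (\<integral>x. exp (r x) \<partial>M) < exp m"
  proof -
    have "(\<integral>x. D x \<partial>M) \<le> 0" using that by (simp add: iD)
    then have "(\<integral>x. D x \<partial>M) = 0" using integral_nonneg_AE[OF D0] by linarith
    then have "AE x in M. D x = 0" using integral_nonneg_eq_0_iff_AE[OF intD D0] by simp
    then have "AE x in M. p x - q x = \<alpha> - \<beta> \<and> r x = l * p x + (1 - l) * q x"
      using AE_space
    proof eventually_elim
      case (elim x)
      then show ?case
        using weighted_exp_convexity(2)[OF l le'[of x]] by (auto simp: D_def m_def algebra_simps)
    qed
    then show ?thesis by blast
  qed
  then show ?thesis unfolding em by blast
qed

text \<open>A nonempty open set is not negligible. This upgrades almost-everywhere identities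
  between continuous functions to identities everywhere.\<close>

lemma AE_lborel_closed_imp_UNIV:
  fixes C :: "'a::euclidean_space set"
  assumes "AE x in lborel. x \<in> C" and "closed C"
  shows "C = UNIV"
proof (rule ccontr)
  assume "C \<noteq> UNIV"
  then have "- C \<noteq> {}" "open (- C)" using assms by auto
  moreover have "{x \<in> space lborel. x \<notin> C} = - C" by auto
  then have "- C \<in> null_sets lborel"
    using assms AE_iff_null[of lborel "\<lambda>x. x \<in> C"] borel_open[of "- C"] by (simp add: open_Compl)
  then have "negligible (- C)" using negligible_iff_null_sets null_sets_completionI by blast
  ultimately show False using open_not_negligible by blast
qed

section \<open>Polynomials\<close>

lemma pos_hom_polysD:
  fixes f :: "real^'n \<Rightarrow> real"
  assumes "f \<in> pos_hom_polys d"
  shows "real_polynomial_function f" "r > 0 \<Longrightarrow> f (r *\<^sub>R x) = r ^ d * f x" "x \<noteq> 0 \<Longrightarrow> f x > 0"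
    "continuous_on S f"
  using assms by (auto simp: pos_hom_polys_def continuous_on_eq_continuous_within
      continuous_real_polymonial_function continuous_at_imp_continuous_at_within)

lemma pos_hom_polys_zero:
  fixes f :: "real^'n \<Rightarrow> real"
  assumes "f \<in> pos_hom_polys d" and "d > 0"
  shows "f 0 = 0"
proof -
  have "f 0 = 2 ^ d * f 0" using pos_hom_polysD(2)[OF assms(1), of 2 0] by simp
  moreover have "(2::real) ^ d > 1" using \<open>d > 0\<close> by simp
  ultimately show ?thesis by simp
qed

lemma pos_hom_polys_nonneg:
  fixes f :: "real^'n \<Rightarrow> real"
  assumes f: "f \<in> pos_hom_polys d" and d: "d > 0"
  shows "0 \<le> f x"
  using pos_hom_polysD(3)[OF f] pos_hom_polys_zero[OF f d] by (cases "x = 0") (auto intro: less_imp_le)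

lemma pos_hom_polys_convex_comb:
  fixes f g :: "real^'n \<Rightarrow> real"
  assumes f: "f \<in> pos_hom_polys d" and g: "g \<in> pos_hom_polys d" and l: "0 < l" "l < 1"
  shows "(\<lambda>x. l * f x + (1 - l) * g x) \<in> pos_hom_polys d"
proof -
  have "real_polynomial_function (\<lambda>x. l * f x + (1 - l) * g x)"
    using f g by (auto simp: pos_hom_polys_def intro!: real_polynomial_function.intros(2-4))
  moreover have "0 < l * f x + (1 - l) * g x" if "x \<noteq> 0" for x
    using l pos_hom_polysD(3)[OF f that] pos_hom_polysD(3)[OF g that] by (simp add: add_pos_pos)
  ultimately show ?thesis
    using pos_hom_polysD(2)[OF f] pos_hom_polysD(2)[OF g]
    by (simp add: pos_hom_polys_def algebra_simps)
qed

text \<open>The constant is the minimum over the compact unit sphere; homogeneity spreads the bound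
  along rays.\<close>

lemma pos_hom_polys_lower_bound:
  fixes f :: "real^'n \<Rightarrow> real"
  assumes f: "f \<in> pos_hom_polys d" and d: "d > 0"
  obtains c where "c > 0" "\<And>x. c * norm x ^ d \<le> f x"
proof -
  note D = pos_hom_polysD[OF f]
  obtain v :: "real^'n" where "norm v = 1" using vector_choose_size[of 1] by auto
  then have "sphere (0::real^'n) 1 \<noteq> {}" by auto
  then obtain x0 where x0: "x0 \<in> sphere 0 1" "\<And>x. x \<in> sphere 0 1 \<Longrightarrow> f x0 \<le> f x"
    using continuous_attains_inf[OF compact_sphere _ D(4)] by blast
  have c: "f x0 > 0" using x0(1) by (intro D(3)) auto
  have "f x0 * norm x ^ d \<le> f x" for x
  proof (cases "x = 0")
    case True
    then show ?thesis using pos_hom_polys_zero[OF f d] d by (simp add: zero_power)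
  next
    case False
    then have "f x = norm x ^ d * f (x /\<^sub>R norm x)"
      using D(2)[of "norm x" "x /\<^sub>R norm x"] by simp
    moreover have "f x0 \<le> f (x /\<^sub>R norm x)" using False by (intro x0(2)) simp
    then have "f x0 * norm x ^ d \<le> f (x /\<^sub>R norm x) * norm x ^ d" by (rule mult_right_mono) simp
    ultimately show ?thesis by (simp add: mult.commute)
  qed
  with c that show ?thesis by blast
qed

text \<open>A quadratic bound makes Gaussians dominate \<open>exp (- f x)\<close>. Subtracting
  \<open>c\<close> absorbs the unit ball, where \<open>norm x ^ d\<close> may be smaller than the
  square.\<close>

lemma pos_hom_polys_quadratic_bound:
  fixes f :: "real^'n \<Rightarrow> real"
  assumes f: "f \<in> pos_hom_polys d" and d: "d \<ge> 2"
  obtains c where "c > 0" "\<And>x. c * (norm x)\<^sup>2 - c \<le> f x"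
proof -
  obtain c where c: "c > 0" "\<And>x. c * norm x ^ d \<le> f x"
    using pos_hom_polys_lower_bound[OF f] d by auto
  have "(norm x)\<^sup>2 - 1 \<le> norm x ^ d" for x :: "real^'n"
  proof (cases "norm x \<ge> 1")
    case True
    then show ?thesis using power_increasing[OF d True] by simp
  next
    case False
    then have "(norm x)\<^sup>2 \<le> 1" by (simp add: power_le_one)
    moreover have "0 \<le> norm x ^ d" by simp
    ultimately show ?thesis by linarith
  qed
  then have "c * ((norm x)\<^sup>2 - 1) \<le> c * norm x ^ d" for x :: "real^'n"
    using c(1) by (intro mult_left_mono) auto
  then have "c * (norm x)\<^sup>2 - c \<le> f x" for x
    using c(2)[of x] by (simp add: right_diff_distrib) (meson order_trans)
  with c(1) that show ?thesis by blast
qed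

section \<open>Polynomial gradients and zero sets of polynomials\<close>

lemma real_polynomial_function_gradient:
  fixes p :: "'a::euclidean_space \<Rightarrow> real"
  assumes "real_polynomial_function p"
  obtains G :: "'a \<Rightarrow> 'a" where "polynomial_function G"
    "\<And>x. (p has_derivative (\<lambda>v. G x \<bullet> v)) (at x)"
proof -
  \<comment> \<open>Induction on the construction of \<open>p\<close> keeps the gradient polynomial;
    its continuity and differentiability are what the argument on images of negligible sets uses
    later.\<close>
  have "\<exists>G :: 'a \<Rightarrow> 'a. polynomial_function G \<and> (\<forall>x. (p has_derivative (\<lambda>v. G x \<bullet> v)) (at x))"
    using assms
  proof induction
    case (linear f)
    define a where "a = (\<Sum>b\<in>Basis. f b *\<^sub>R b)"
    have "f v = a \<bullet> v" for v
    proof -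
      have "f v = f (\<Sum>b\<in>Basis. (v \<bullet> b) *\<^sub>R b)" by (simp add: euclidean_representation)
      also have "\<dots> = (\<Sum>b\<in>Basis. (v \<bullet> b) * f b)"
        using bounded_linear.linear[OF linear] by (simp add: linear_sum linear_scale)
      also have "\<dots> = a \<bullet> v" by (simp add: a_def inner_sum_left inner_commute[of v] mult.commute)
      finally show ?thesis .
    qed
    then have "f = (\<lambda>v. a \<bullet> v)" by auto
    moreover have "(f has_derivative f) (at x)" for x
      using linear bounded_linear_imp_has_derivative by blast
    ultimately show ?case by (intro exI[of _ "\<lambda>_. a"]) auto
  next
    case (const c)
    show ?case by (intro exI[of _ "\<lambda>_. 0"]) auto
  next
    case (add f g)
    then obtain F G :: "'a \<Rightarrow> 'a" where "polynomial_function F" "polynomial_function G"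
      "\<And>x. (f has_derivative (\<lambda>v. F x \<bullet> v)) (at x)" "\<And>x. (g has_derivative (\<lambda>v. G x \<bullet> v)) (at x)"
      by blast
    then show ?case
      by (intro exI[of _ "\<lambda>x. F x + G x"]) (auto simp: inner_add_left intro!: has_derivative_add)
  next
    case (mult f g)
    then obtain F G :: "'a \<Rightarrow> 'a" where FG: "polynomial_function F" "polynomial_function G"
      "\<And>x. (f has_derivative (\<lambda>v. F x \<bullet> v)) (at x)" "\<And>x. (g has_derivative (\<lambda>v. G x \<bullet> v)) (at x)"
      by blast
    have "((\<lambda>x. f x * g x) has_derivative (\<lambda>v. (f x *\<^sub>R G x + g x *\<^sub>R F x) \<bullet> v)) (at x)" for x
      using has_derivative_mult[OF FG(3,4)] by (simp add: inner_add_left mult.commute)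
    moreover have "polynomial_function (\<lambda>x. f x *\<^sub>R G x + g x *\<^sub>R F x)"
      using FG mult by (intro polynomial_function_add polynomial_function_mult)
        (auto simp: real_polynomial_function_eq)
    ultimately show ?case by blast
  qed
  then show ?thesis using that by blast
qed

text \<open>On every line through the origin \<open>p\<close> is a univariate polynomial with
  nonzero value at 0, hence has finitely many zeros there. Exchanging the quantifiers by Fubini
  gives a scale \<open>t\<close> at which \<open>p (t *\<^sub>R y)\<close> is nonzero for almost
  every \<open>y\<close>, and rescaling by \<open>t\<close> finishes.\<close>

lemma negligible_zeros_polynomial_nonzero_at_0:
  fixes p :: "'a::euclidean_space \<Rightarrow> real"
  assumes p: "real_polynomial_function p" and p0: "p 0 \<noteq> 0"
  shows "negligible {x. p x = 0}"
proof -
  have cont: "continuous_on S p" for S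
    using p by (simp add: continuous_on_eq_continuous_within continuous_real_polymonial_function
        continuous_at_imp_continuous_at_within)
  then have [measurable]: "p \<in> borel_measurable borel"
    by (intro borel_measurable_continuous_onI)
  have fin: "finite {t. p (t *\<^sub>R y) = 0}" for y
  proof -
    have "polynomial_function (\<lambda>t. t *\<^sub>R y)"
      by (intro polynomial_function_bounded_linear bounded_linear_scaleR_left)
    from real_polynomial_function_compose[OF this p]
    have "real_polynomial_function (\<lambda>t. p (t *\<^sub>R y))" by (simp add: o_def)
    then obtain a n where a: "(\<lambda>t. p (t *\<^sub>R y)) = (\<lambda>t. \<Sum>i\<le>n. a i * t ^ i)"
      using real_polynomial_function_iff_sum by blast
    have "p (t *\<^sub>R y) = (\<Sum>i\<le>n. a i * t ^ i)" for t using fun_cong[OF a] .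
    moreover have "\<exists>k\<le>n. a k \<noteq> 0"
    proof (rule ccontr)
      assume "\<not> (\<exists>k\<le>n. a k \<noteq> 0)"
      then have "p (0 *\<^sub>R y) = 0" unfolding \<open>p (0 *\<^sub>R y) = _\<close> by (intro sum.neutral) auto
      then show False using p0 by simp
    qed
    ultimately show ?thesis using polyfun_finite_roots[where c = a and n = n] by simp
  qed
  have "AE t in lborel. p (t *\<^sub>R y) \<noteq> 0" for y
    by (rule AE_I'[OF finite_imp_null_set_lborel[OF fin[of y]]]) auto
  then have "AE y in (lborel :: 'a measure). AE t in (lborel :: real measure). p (t *\<^sub>R y) \<noteq> 0" by simp
  then have "AE t in (lborel :: real measure). AE y in (lborel :: 'a measure). p (t *\<^sub>R y) \<noteq> 0"
    by (subst lborel_pair.AE_commute) measurable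
  \<comment> \<open>The condition that \<open>t\<close> is nonzero makes the dilation by
    \<open>t\<close> map the null set onto the whole zero set of \<open>p\<close>.\<close>
  moreover define Q where "Q t \<longleftrightarrow> t \<noteq> 0 \<and> (AE y in (lborel :: 'a measure). p (t *\<^sub>R y) \<noteq> 0)" for t
  ultimately have Q: "AE t in lborel. Q t"
    using AE_lborel_singleton[of "0::real"] by simp
  have "\<exists>t. Q t"
  proof (rule ccontr)
    assume "\<nexists>t. Q t"
    then have "AE t in (lborel :: real measure). t \<in> {}" using Q by simp
    from AE_lborel_closed_imp_UNIV[OF this] show False by simp
  qed
  then obtain t where t: "t \<noteq> 0" "AE y in (lborel :: 'a measure). p (t *\<^sub>R y) \<noteq> 0"
    unfolding Q_def by blast
  have "{y. p (t *\<^sub>R y) = 0} \<in> null_sets lborel"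
    using t(2) AE_iff_null[of lborel "\<lambda>y. p (t *\<^sub>R y) \<noteq> 0"] by simp
  then have "negligible {y. p (t *\<^sub>R y) = 0}"
    using negligible_iff_null_sets null_sets_completionI by blast
  then have "negligible ((\<lambda>y. t *\<^sub>R y) ` {y. p (t *\<^sub>R y) = 0})"
    by (intro negligible_differentiable_image_negligible linear_imp_differentiable_on) (auto intro: linear_scaleR)
  also have "(\<lambda>y. t *\<^sub>R y) ` {y. p (t *\<^sub>R y) = 0} = {x. p x = 0}"
  proof (intro equalityI subsetI)
    fix x assume "x \<in> {x. p x = 0}"
    then show "x \<in> (\<lambda>y. t *\<^sub>R y) ` {y. p (t *\<^sub>R y) = 0}"
      using t(1) by (intro image_eqI[of _ _ "x /\<^sub>R t"]) auto
  qed auto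
  finally show ?thesis .
qed

text \<open>Translate a point where \<open>p\<close> does not vanish to the origin.\<close>

lemma negligible_zeros_polynomial:
  fixes p :: "'a::euclidean_space \<Rightarrow> real"
  assumes p: "real_polynomial_function p" and a: "p a \<noteq> 0"
  shows "negligible {x. p x = 0}"
proof -
  have "real_polynomial_function (p \<circ> (\<lambda>x. a + x))"
    by (intro real_polynomial_function_compose p polynomial_function_add) auto
  then have "negligible ((+) a ` {x. p (a + x) = 0})"
    using a by (intro negligible_translation negligible_zeros_polynomial_nonzero_at_0) (auto simp: o_def)
  also have "(+) a ` {x. p (a + x) = 0} = {x. p x = 0}"
    by (force intro: image_eqI[of _ _ "_ - a"])
  finally show ?thesis .
qed

section \<open>Gradients of positive homogeneous polynomials\<close>

lemma pos_hom_polys_Euler: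
  fixes h :: "real^'n \<Rightarrow> real"
  assumes h: "h \<in> pos_hom_polys d" and G: "(h has_derivative (\<lambda>v. G \<bullet> v)) (at x)"
  shows "G \<bullet> x = real d * h x"
proof -
  have "((\<lambda>t. h (t *\<^sub>R x)) has_derivative (\<lambda>t. G \<bullet> (t *\<^sub>R x))) (at 1)"
    by (rule has_derivative_compose[of "\<lambda>t. t *\<^sub>R x" "\<lambda>t. t *\<^sub>R x" 1 UNIV h "\<lambda>v. G \<bullet> v"])
       (use G in \<open>auto intro!: derivative_eq_intros\<close>)
  then have "((\<lambda>t. h (t *\<^sub>R x)) has_real_derivative G \<bullet> x) (at 1)"
    by (simp add: has_field_derivative_def mult_commute_abs)
  moreover have "((\<lambda>t. t ^ d * h x) has_real_derivative real d * h x) (at 1)"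
    by (auto intro!: derivative_eq_intros)
  \<comment> \<open>Homogeneity is available for positive factors only, so the two functions of
    \<open>t\<close> are compared on the open half-line around 1.\<close>
  then have "((\<lambda>t. h (t *\<^sub>R x)) has_real_derivative real d * h x) (at 1)"
    by (rule has_field_derivative_transform_within_open[of _ _ _ "{0<..}"])
       (use pos_hom_polysD(2)[OF h] in auto)
  ultimately show ?thesis by (rule DERIV_unique)
qed

text \<open>Minimise \<open>h\<close> on the affine hyperplane of inner product 1 with
  \<open>u\<close>. By the Lagrange condition the gradient there is a multiple of \<open>u\<close>,
  and rescaling the minimiser turns the multiplier into 1 while preserving minimality on the
  parallel hyperplane.\<close>

lemma pos_hom_polys_hyperplane_minimiser:
  fixes h :: "real^'n \<Rightarrow> real"
  assumes h: "h \<in> pos_hom_polys d" and d: "d \<ge> 2"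
    and G: "\<And>x. (h has_derivative (\<lambda>v. G x \<bullet> v)) (at x)" and u: "u \<noteq> 0"
  obtains x where "G x = u" "\<And>w. w \<bullet> u = 0 \<Longrightarrow> h x \<le> h (x + w)"
proof -
  note D = pos_hom_polysD[OF h]
  have uu: "u \<bullet> u > 0" using u by simp
  obtain c where c: "c > 0" "\<And>x. c * (norm x)\<^sup>2 - c \<le> h x"
    using pos_hom_polys_quadratic_bound[OF h d] by blast
  \<comment> \<open>The multiple of \<open>u\<close> on the hyperplane. Its value cuts out a
    nonempty sublevel set \<open>K\<close>, which is compact by the quadratic bound.\<close>
  define a where "a = u /\<^sub>R (u \<bullet> u)"
  define K where "K = {x. x \<bullet> u = 1} \<inter> {x. h x \<le> h a}"
  have "closed K" unfolding K_def
    by (intro closed_Int closed_Collect_eq closed_Collect_le continuous_intros D(4))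
  moreover have "bounded K"
  proof (rule boundedI)
    fix x assume "x \<in> K"
    then have "c * (norm x)\<^sup>2 \<le> h a + c" using c(2)[of x] by (simp add: K_def)
    then have "(norm x)\<^sup>2 \<le> (h a + c) / c" using c(1) by (simp add: pos_le_divide_eq mult.commute)
    then show "norm x \<le> sqrt ((h a + c) / c)" by (rule real_le_rsqrt)
  qed
  ultimately have K: "compact K" by (simp add: compact_eq_bounded_closed)
  have "a \<in> K" using uu by (simp add: K_def a_def)
  then have "K \<noteq> {}" by auto
  from continuous_attains_inf[OF K this D(4)]
  obtain x0 where x0: "x0 \<in> K" "\<And>x. x \<in> K \<Longrightarrow> h x0 \<le> h x" by auto
  have min0: "h x0 \<le> h x" if "x \<bullet> u = 1" for x
    using x0 that by (cases "h x \<le> h a") (auto simp: K_def)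
  have x0u: "x0 \<bullet> u = 1" using x0(1) by (simp add: K_def)
  then have "x0 \<noteq> 0" by auto
  then have h0: "h x0 > 0" by (rule D(3))
  \<comment> \<open>By Euler's identity the multiplier at \<open>x0\<close> is
    \<open>real d * h x0\<close>, and scaling by \<open>s\<close> multiplies a gradient of degree
    \<open>d - 1\<close> by \<open>s ^ (d - 1)\<close>; this \<open>s\<close> makes the product
    1.\<close>
  define s where "s = root (d - 1) (1 / (real d * h x0))"
  have s: "s > 0" using d h0 by (simp add: s_def)
  have sd: "s ^ (d - 1) * (real d * h x0) = 1"
    using d h0 by (simp add: s_def real_root_pow_pos2)
  have min: "h (s *\<^sub>R x0) \<le> h (s *\<^sub>R x0 + w)" if "w \<bullet> u = 0" for w
  proof -
    have "h x0 \<le> h (x0 + w /\<^sub>R s)" using that by (intro min0) (simp add: inner_add_left x0u)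
    moreover have "s *\<^sub>R x0 + w = s *\<^sub>R (x0 + w /\<^sub>R s)" using s by (simp add: scaleR_add_right)
    ultimately show ?thesis using s by (simp add: D(2)[OF s])
  qed
  define g where "g = G (s *\<^sub>R x0)"
  have perp: "g \<bullet> w = 0" if w: "w \<bullet> u = 0" for w
  proof -
    have 1: "((\<lambda>t. s *\<^sub>R x0 + t *\<^sub>R w) has_derivative (\<lambda>t. t *\<^sub>R w)) (at 0)"
      by (auto intro!: derivative_eq_intros)
    have "(h has_derivative (\<lambda>v. g \<bullet> v)) (at (s *\<^sub>R x0 + 0 *\<^sub>R w))"
      using G[of "s *\<^sub>R x0"] by (simp add: g_def)
    from has_derivative_compose[OF 1 this]
    have "((\<lambda>t. h (s *\<^sub>R x0 + t *\<^sub>R w)) has_derivative (\<lambda>t. t * (g \<bullet> w))) (at 0)"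
      by simp
    then have "((\<lambda>t. h (s *\<^sub>R x0 + t *\<^sub>R w)) has_real_derivative g \<bullet> w) (at 0)"
      by (simp add: has_field_derivative_def mult_commute_abs)
    then show ?thesis
      by (rule DERIV_local_min[OF _ zero_less_one]) (simp add: min w)
  qed
  define k where "k = (g \<bullet> u) / (u \<bullet> u)"
  have "(g - k *\<^sub>R u) \<bullet> u = 0" using uu by (simp add: inner_diff_left k_def)
  from perp[OF this] this have "(g - k *\<^sub>R u) \<bullet> (g - k *\<^sub>R u) = 0"
    by (simp add: inner_diff_right inner_diff_left inner_commute)
  then have gk: "g = k *\<^sub>R u" by simp
  \<comment> \<open>As \<open>x0\<close> has inner product 1 with \<open>u\<close>, pairing the
    gradient with \<open>s *\<^sub>R x0\<close> reads off the multiplier through Euler's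
    identity.\<close>
  have "k * s = g \<bullet> (s *\<^sub>R x0)" using x0u by (simp add: gk inner_commute)
  also have "\<dots> = real d * h (s *\<^sub>R x0)" unfolding g_def by (rule pos_hom_polys_Euler[OF h G])
  also have "\<dots> = real d * (s * s ^ (d - 1) * h x0)"
  proof -
    have "s ^ d = s * s ^ (d - 1)" using d by (cases d) auto
    then show ?thesis by (simp add: D(2)[OF s])
  qed
  also have "\<dots> = s" using sd by (simp add: mult_ac)
  finally have "k = 1" using s by simp
  then have "G (s *\<^sub>R x0) = u" using gk unfolding g_def by simp
  then show ?thesis using that min by blast
qed

text \<open>For distinct \<open>f\<close> and \<open>g\<close> the coincidence set is negligible,
  and so is its image under the differentiable map \<open>G\<close>. But \<open>G\<close> is proper,
  so a dense image of a closed set already contains every nonzero vector.\<close>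

lemma gradient_coincidence_set_dense_imp_eq:
  fixes f g h :: "real^'n \<Rightarrow> real"
  assumes f: "f \<in> pos_hom_polys d" and g: "g \<in> pos_hom_polys d" and h: "h \<in> pos_hom_polys d"
    and d: "d \<ge> 2"
    and G: "polynomial_function G" "\<And>x. (h has_derivative (\<lambda>v. G x \<bullet> v)) (at x)"
    and dense: "\<And>u e. e > 0 \<Longrightarrow> \<exists>v. dist u v < e \<and> (v \<noteq> 0 \<longrightarrow> v \<in> G ` {x. f x = g x})"
  shows "f = g"
proof (rule ccontr)
  assume "f \<noteq> g"
  then obtain a where "f a - g a \<noteq> 0" by fastforce
  then have "negligible {x. f x - g x = 0}"
    using pos_hom_polysD(1)[OF f] pos_hom_polysD(1)[OF g]
    by (intro negligible_zeros_polynomial real_polynomial_function_diff) auto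
  then have "negligible (G ` {x. f x = g x})"
    using G(1) by (intro negligible_differentiable_image_negligible)
      (auto intro: differentiable_on_polynomial_function)
  then have neg: "negligible (insert 0 (G ` {x. f x = g x}))" by simp
  obtain c where c: "c > 0" "\<And>x. c * norm x ^ d \<le> h x"
    using pos_hom_polys_lower_bound[OF h] d by auto
  \<comment> \<open>Outside the unit ball \<open>c * (norm x)\<^sup>2\<close> is at most
    \<open>h x\<close>, hence at most \<open>G x \<bullet> x\<close> by Euler's identity;
    Cauchy-Schwarz then bounds \<open>norm x\<close> by \<open>norm (G x) / c\<close>.\<close>
  have coercive: "norm x \<le> 1 + norm (G x) / c" for x
  proof (cases "norm x \<le> 1")
    case True
    then show ?thesis using c(1) by (simp add: add_increasing2)
  next
    case False
    have "c * norm x * norm x \<le> c * norm x ^ d"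
      using False c(1) power_increasing[OF d, of "norm x"] by (simp add: power2_eq_square)
    also have "\<dots> \<le> 1 * h x" using c(2) by simp
    also have "\<dots> \<le> real d * h x"
      using d c order_trans[OF _ c(2)[of x], of 0] by (intro mult_right_mono) auto
    also have "\<dots> = G x \<bullet> x" by (rule pos_hom_polys_Euler[OF h G(2), symmetric])
    also have "\<dots> \<le> norm (G x) * norm x" by (rule norm_cauchy_schwarz)
    finally have "c * norm x \<le> norm (G x)"
      by (rule mult_right_le_imp_le) (use False in linarith)
    then show ?thesis using c(1) by (simp add: field_simps)
  qed
  have "u \<in> G ` {x. f x = g x}" if u: "u \<noteq> 0" for u
  proof -
    \<comment> \<open>The radius that coercivity gives for all preimages of points within distance 1
      of \<open>u\<close>.\<close>
    define R where "R = 1 + (norm u + 1) / c"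
    define K where "K = G ` ({x. f x = g x} \<inter> cball 0 R)"
    have "compact K" unfolding K_def
      by (intro compact_continuous_image continuous_on_polymonial_function G closed_Int_compact
          closed_Collect_eq pos_hom_polysD(4)[OF f] pos_hom_polysD(4)[OF g] compact_cball)
    moreover have "u \<in> closure K"
    proof (unfold closure_approachable, intro allI impI)
      fix e :: real assume "e > 0"
      \<comment> \<open>The bound 1 keeps the preimage in the ball of radius \<open>R\<close>; the
        bound \<open>norm u\<close> forces \<open>v\<close> to be nonzero, the only case in which
        the density hypothesis supplies a preimage.\<close>
      then have "min e (min 1 (norm u)) > 0" using u by simp
      from dense[OF this] obtain v where v: "dist u v < e" "dist u v < 1" "dist u v < norm u"
          "v \<noteq> 0 \<longrightarrow> v \<in> G ` {x. f x = g x}" by force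
      then have "v \<noteq> 0" by auto
      with v obtain x where x: "f x = g x" "v = G x" by blast
      have "norm (G x) \<le> norm u + 1"
        using v(2) norm_triangle_ineq2[of v u] by (simp add: x dist_norm norm_minus_commute)
      then have "norm x \<le> R"
        using coercive[of x] c(1) unfolding R_def
        by (meson add_left_mono divide_right_mono less_imp_le order_trans)
      then have "v \<in> K" using x by (auto simp: K_def)
      then show "\<exists>y\<in>K. dist y u < e" using v(1) by (auto simp: dist_commute)
    qed
    ultimately have "u \<in> K" by (simp add: compact_imp_closed closure_closed)
    then show ?thesis by (auto simp: K_def)
  qed
  then have "insert 0 (G ` {x. f x = g x}) = UNIV" by blast
  then show False using neg by simp
qed

section \<open>Integration over the Grassmannian\<close>

lemma is_grassmann_haar_facts:
  assumes j: "j \<le> CARD('n)"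
  defines "\<nu> \<equiv> grassmann_haar j :: (real^'n) set measure"
  shows sets_grassmann_haar: "sets \<nu> = sets (grassmann_borel j)"
    and prob_space_grassmann_haar: "prob_space \<nu>"
    and emeasure_grassmann_haar_rotation: "rotation_matrix Q \<Longrightarrow> A \<in> sets \<nu> \<Longrightarrow>
      emeasure \<nu> ((\<lambda>E. (*v) Q ` E) ` A) = emeasure \<nu> A"
    and space_grassmann_haar: "space \<nu> = grassmannian j"
proof -
  have h: "is_grassmann_haar j \<nu>" unfolding \<nu>_def by (rule is_grassmann_haar_grassmann_haar[OF j])
  then show s: "sets \<nu> = sets (grassmann_borel j)" and "prob_space \<nu>"
    and "rotation_matrix Q \<Longrightarrow> A \<in> sets \<nu> \<Longrightarrow>
      emeasure \<nu> ((\<lambda>E. (*v) Q ` E) ` A) = emeasure \<nu> A"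
    by (auto simp: is_grassmann_haar_def intro: prob_spaceI)
  show "space \<nu> = grassmannian j" using sets_eq_imp_space_eq[OF s] by simp
qed

text \<open>The sigma-algebra on the Grassmannian is generated by the projection matrix, and
  applying a measurable matrix to a measurable vector is measurable.\<close>

lemma borel_measurable_projection_grassmann_borel:
  assumes v: "v \<in> borel_measurable (grassmann_borel j \<Otimes>\<^sub>M N)"
  shows "(\<lambda>p. closest_point (fst p) (v p)) \<in> borel_measurable (grassmann_borel j \<Otimes>\<^sub>M N)"
proof -
  have "(\<lambda>E. matrix (closest_point E)) \<in> measurable (grassmann_borel j) borel"
    unfolding grassmann_borel_def by (rule measurable_vimage_algebra1) auto
  then have "(\<lambda>p. matrix (closest_point (fst p)) *v v p) \<in> borel_measurable (grassmann_borel j \<Otimes>\<^sub>M N)"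
    by (intro borel_measurable_matrix_vector v measurable_compose[OF measurable_fst])
  then show ?thesis
    by (rule measurable_cong[THEN iffD1, rotated])
       (auto simp: space_pair_measure grassmannian_def matrix_closest_point_works)
qed

lemma norm_diff_closest_point_subspace:
  fixes E :: "'a::euclidean_space set"
  assumes E: "subspace E"
  shows "(norm x)\<^sup>2 = (norm (closest_point E x))\<^sup>2 + (norm (x - closest_point E x))\<^sup>2"
  using norm_add_Pythagorean[of "closest_point E x" "x - closest_point E x"]
    closest_point_subspace[OF E] by (simp add: orthogonal_def inner_commute)

text \<open>A common setting for projections and restrictions. Joint measurability is asked after
  projecting to \<open>E\<close>, and the growth constant is uniform in \<open>E\<close>.\<close>

definition coercive_family :: "nat \<Rightarrow> ((real^'n) set \<Rightarrow> real^'n \<Rightarrow> real) \<Rightarrow> bool" where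
  "coercive_family j A \<longleftrightarrow>
     (\<lambda>p. A (fst p) (closest_point (fst p) (snd p))) \<in> borel_measurable (grassmann_borel j \<Otimes>\<^sub>M borel) \<and>
     (\<forall>E\<in>grassmannian j. A E \<in> borel_measurable borel) \<and>
     (\<exists>c>0. \<forall>E\<in>grassmannian j. \<forall>y\<in>E. c * (norm y)\<^sup>2 - c \<le> A E y)"

text \<open>The exponent of the integrand after adding the Gaussian weight orthogonal to
  \<open>E\<close>. The iterated integral over varying subspaces thus becomes one over a fixed
  product space, where Hoelder and Fubini apply.\<close>

definition gauss_extension :: "((real^'n) set \<Rightarrow> real^'n \<Rightarrow> real) \<Rightarrow> (real^'n) set \<times> (real^'n) \<Rightarrow> real" where
  "gauss_extension A p = - A (fst p) (closest_point (fst p) (snd p))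
     - (norm (snd p - closest_point (fst p) (snd p)))\<^sup>2"

lemma integrable_gauss_extension:
  fixes A :: "(real^'n) set \<Rightarrow> real^'n \<Rightarrow> real"
  assumes j: "j \<le> CARD('n)" and A: "coercive_family j A"
  shows "integrable (grassmann_haar j \<Otimes>\<^sub>M lborel) (\<lambda>p. exp (gauss_extension A p))"
proof -
  define \<nu> where "\<nu> = (grassmann_haar j :: (real^'n) set measure)"
  interpret prob_space \<nu> unfolding \<nu>_def by (rule prob_space_grassmann_haar[OF j])
  have s[measurable_cong]: "sets \<nu> = sets (grassmann_borel j)"
    unfolding \<nu>_def by (rule sets_grassmann_haar[OF j])
  have sp: "space \<nu> = grassmannian j" unfolding \<nu>_def by (rule space_grassmann_haar[OF j])
  have cong: "measurable (\<nu> \<Otimes>\<^sub>M lborel) N = measurable (grassmann_borel j \<Otimes>\<^sub>M borel) N"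
    for N :: "'b measure"
    by (intro measurable_cong_sets sets_pair_measure_cong s) auto
  have [measurable]: "(\<lambda>p. closest_point (fst p) (snd p)) \<in> borel_measurable (\<nu> \<Otimes>\<^sub>M lborel)"
    unfolding cong by (rule borel_measurable_projection_grassmann_borel) measurable
  have [measurable]: "(\<lambda>p. A (fst p) (closest_point (fst p) (snd p))) \<in> borel_measurable (\<nu> \<Otimes>\<^sub>M lborel)"
    using A unfolding cong coercive_family_def by blast
  have m: "(\<lambda>p. exp (gauss_extension A p)) \<in> borel_measurable (\<nu> \<Otimes>\<^sub>M lborel)"
    unfolding gauss_extension_def by measurable
  obtain c where c: "c > 0" "\<And>E y. E \<in> grassmannian j \<Longrightarrow> y \<in> E \<Longrightarrow> c * (norm y)\<^sup>2 - c \<le> A E y"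
    using A by (auto simp: coercive_family_def)
  \<comment> \<open>The tangential part decays at rate \<open>c\<close> and the normal part at rate
    1; by Pythagoras the smaller rate controls the full norm.\<close>
  define c' where "c' = min c 1"
  have c': "c' > 0" "c' \<le> c" "c' \<le> 1" using c by (auto simp: c'_def)
  have bound: "gauss_extension A (E, x) \<le> c - c' * (norm x)\<^sup>2" if E: "E \<in> grassmannian j" for E x
  proof -
    have sub: "subspace E" using E by (simp add: grassmannian_def)
    have "c' * (norm (closest_point E x))\<^sup>2 \<le> c * (norm (closest_point E x))\<^sup>2"
      "c' * (norm (x - closest_point E x))\<^sup>2 \<le> 1 * (norm (x - closest_point E x))\<^sup>2"
      using c' by (intro mult_right_mono; simp)+
    then show ?thesis
      using c(2)[OF E closest_point_subspace(1)[OF sub], of x]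
      unfolding norm_diff_closest_point_subspace[OF sub, of x] gauss_extension_def
      by (simp add: distrib_left)
  qed
  have "integrable (\<nu> \<Otimes>\<^sub>M lborel) (\<lambda>p. exp (gauss_extension A p))"
  proof (rule integrableI_nonneg[OF m])
    have "(\<integral>\<^sup>+p. ennreal (exp (gauss_extension A p)) \<partial>(\<nu> \<Otimes>\<^sub>M lborel))
        = (\<integral>\<^sup>+E. \<integral>\<^sup>+x. ennreal (exp (gauss_extension A (E, x))) \<partial>lborel \<partial>\<nu>)"
      using m by (intro lborel.nn_integral_fst[symmetric]) simp
    also have "\<dots> \<le> (\<integral>\<^sup>+E. \<integral>\<^sup>+x. ennreal (exp c) * ennreal (exp (- (c' * (norm (x :: real^'n))\<^sup>2))) \<partial>lborel \<partial>\<nu>)"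
      using bound by (intro nn_integral_mono) (auto simp: sp simp flip: ennreal_mult exp_add)
    also have "\<dots> = ennreal (exp c) * (\<integral>\<^sup>+x. ennreal (exp (- (c' * (norm (x :: real^'n))\<^sup>2))) \<partial>lborel)"
      by (simp add: nn_integral_cmult emeasure_space_1)
    also have "\<dots> < \<infinity>"
      using nn_integral_exp_minus_norm_square_finite[OF c'(1), where 'a="real^'n"]
      by (simp add: ennreal_mult_less_top)
    finally show "(\<integral>\<^sup>+p. ennreal (exp (gauss_extension A p)) \<partial>(\<nu> \<Otimes>\<^sub>M lborel)) < \<infinity>" .
  qed simp
  then show ?thesis by (simp add: \<nu>_def)
qed

text \<open>On each fibre the Gaussian contributes the same power of \<open>sqrt pi\<close>, so it
  factors out; Fubini then assembles the fibres.\<close>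

lemma integral_grassmannian_eq:
  fixes A :: "(real^'n) set \<Rightarrow> real^'n \<Rightarrow> real"
  assumes j: "j \<le> CARD('n)" and A: "coercive_family j A"
  shows "(\<integral>E. (\<integral>y. exp (- A E y) \<partial>subspace_lborel E) \<partial>grassmann_haar j)
       = (\<integral>p. exp (gauss_extension A p) \<partial>(grassmann_haar j \<Otimes>\<^sub>M lborel)) / sqrt pi ^ (CARD('n) - j)"
proof -
  define \<nu> where "\<nu> = (grassmann_haar j :: (real^'n) set measure)"
  interpret \<nu>: prob_space \<nu> unfolding \<nu>_def by (rule prob_space_grassmann_haar[OF j])
  interpret pair_sigma_finite \<nu> "lborel :: (real^'n) measure" by standard
  have sp: "space \<nu> = grassmannian j" unfolding \<nu>_def by (rule space_grassmann_haar[OF j])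
  have fibre: "(\<integral>y. exp (- A E y) \<partial>subspace_lborel E)
      = (\<integral>x. exp (gauss_extension A (E, x)) \<partial>lborel) / sqrt pi ^ (CARD('n) - j)"
    if E: "E \<in> grassmannian j" for E
  proof -
    have sub: "subspace E" and dim: "dim E = j" using E by (auto simp: grassmannian_def)
    have m[measurable]: "A E \<in> borel_measurable borel" using A E by (auto simp: coercive_family_def)
    have [measurable]: "closest_point E \<in> borel_measurable borel"
      using linear_closest_point_subspace[OF sub]
      by (intro borel_measurable_continuous_onI linear_continuous_on) (simp add: linear_conv_bounded_linear)
    have sb: "sets (subspace_lborel E) = sets borel"
      by (simp add: subspace_lborel_def Let_def)
    have g: "exp (gauss_extension A (E, x))
        = exp (- A E (closest_point E x)) * exp (- (norm (x - closest_point E x))\<^sup>2)" for x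
      by (simp add: gauss_extension_def exp_diff exp_minus field_simps)
    have "(\<integral>\<^sup>+x. ennreal (exp (gauss_extension A (E, x))) \<partial>lborel)
        = (\<integral>\<^sup>+y. ennreal (exp (- A E y)) \<partial>subspace_lborel E) * ennreal (sqrt pi) ^ (CARD('n) - j)"
      using nn_integral_subspace_lborel[OF sub, of "\<lambda>y. ennreal (exp (- A E y))"]
      by (simp add: g dim ennreal_mult)
    then have "(\<integral>x. exp (gauss_extension A (E, x)) \<partial>lborel)
        = (\<integral>y. exp (- A E y) \<partial>subspace_lborel E) * sqrt pi ^ (CARD('n) - j)"
      by (subst (1 2) integral_eq_nn_integral)
         (auto simp: enn2real_mult ennreal_power gauss_extension_def measurable_cong_sets[OF sb refl])
    then show ?thesis by simp
  qed
  have "(\<integral>E. (\<integral>y. exp (- A E y) \<partial>subspace_lborel E) \<partial>\<nu>)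
      = (\<integral>E. (\<integral>x. exp (gauss_extension A (E, x)) \<partial>lborel) / sqrt pi ^ (CARD('n) - j) \<partial>\<nu>)"
    using fibre by (intro Bochner_Integration.integral_cong refl) (simp add: sp)
  also have "\<dots> = (\<integral>p. exp (gauss_extension A p) \<partial>(\<nu> \<Otimes>\<^sub>M lborel)) / sqrt pi ^ (CARD('n) - j)"
    using integral_fst'[OF integrable_gauss_extension[OF j A, folded \<nu>_def]] by simp
  finally show ?thesis by (simp add: \<nu>_def)
qed

text \<open>The weights sum to 1, so the Gaussian terms match on both sides of the convexity
  inequality and cancel in the case of equality.\<close>

lemma grassmannian_strict_Holder:
  fixes A B H :: "(real^'n) set \<Rightarrow> real^'n \<Rightarrow> real" and j :: nat
  assumes j: "j \<le> CARD('n)" and l: "0 < l" "l < 1"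
    and A: "coercive_family j A" and B: "coercive_family j B" and H: "coercive_family j H"
    and le: "\<And>E y. E \<in> grassmannian j \<Longrightarrow> y \<in> E \<Longrightarrow> l * A E y + (1 - l) * B E y \<le> H E y"
  defines "I \<equiv> \<lambda>F. \<integral>E. (\<integral>y. exp (- F E y) \<partial>subspace_lborel E) \<partial>grassmann_haar j"
  shows "I H < I A powr l * I B powr (1 - l) \<or>
    (\<exists>c. AE E in grassmann_haar j. AE x in lborel. A E (closest_point E x) - B E (closest_point E x) = c
        \<and> H E (closest_point E x) = l * A E (closest_point E x) + (1 - l) * B E (closest_point E x))"
proof -
  define \<nu> where "\<nu> = (grassmann_haar j :: (real^'n) set measure)"
  interpret \<nu>: prob_space \<nu> unfolding \<nu>_def by (rule prob_space_grassmann_haar[OF j])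
  interpret pair_sigma_finite \<nu> "lborel :: (real^'n) measure" by standard
  have sp: "space \<nu> = grassmannian j" unfolding \<nu>_def by (rule space_grassmann_haar[OF j])
  define k where "k = sqrt pi ^ (CARD('n) - j)"
  have k: "k > 0" by (simp add: k_def)
  let ?M = "\<nu> \<Otimes>\<^sub>M (lborel :: (real^'n) measure)"
  let ?J = "\<lambda>F. \<integral>p. exp (gauss_extension F p) \<partial>?M"
  have M: "emeasure ?M (space ?M) \<noteq> 0"
    by (simp add: space_pair_measure lborel.emeasure_pair_measure_Times \<nu>.emeasure_space_1)
  have ge: "gauss_extension H p \<le> l * gauss_extension A p + (1 - l) * gauss_extension B p"
    if "p \<in> space ?M" for p
  proof -
    obtain E x where p: "p = (E, x)" by (cases p)
    then have E: "E \<in> grassmannian j" using that by (auto simp: space_pair_measure sp)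
    then have "closest_point E x \<in> E"
      by (intro closest_point_subspace) (simp add: grassmannian_def)
    from le[OF E this] show ?thesis by (simp add: p gauss_extension_def algebra_simps)
  qed
  have J: "?J H < ?J A powr l * ?J B powr (1 - l) \<or>
      (\<exists>c. AE p in ?M. gauss_extension A p - gauss_extension B p = c
        \<and> gauss_extension H p = l * gauss_extension A p + (1 - l) * gauss_extension B p)"
    using integrable_gauss_extension[OF j, folded \<nu>_def] A B H
    by (intro strict_Holder_or_proportional[OF l _ _ _ M ge])
  show ?thesis
  proof (rule disjE[OF J])
    assume lt: "?J H < ?J A powr l * ?J B powr (1 - l)"
    have I: "I F = ?J F / k" if "coercive_family j F" for F
      using integral_grassmannian_eq[OF j that] by (simp add: I_def k_def \<nu>_def)
    \<comment> \<open>The weighted geometric mean is homogeneous of degree one, so dividing all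
      integrals by \<open>k\<close> preserves the inequality.\<close>
    have "I A powr l * I B powr (1 - l) = ?J A powr l * ?J B powr (1 - l) / (k powr l * k powr (1 - l))"
      using k by (simp add: I A B powr_divide)
    also have "k powr l * k powr (1 - l) = k" using k by (simp flip: powr_add)
    finally have "I H < I A powr l * I B powr (1 - l)"
      using lt k by (simp add: I[OF H] divide_strict_right_mono)
    then show ?thesis ..
  next
    assume "\<exists>c. AE p in ?M. gauss_extension A p - gauss_extension B p = c
        \<and> gauss_extension H p = l * gauss_extension A p + (1 - l) * gauss_extension B p"
    then obtain c where "AE p in ?M. gauss_extension A p - gauss_extension B p = c
        \<and> gauss_extension H p = l * gauss_extension A p + (1 - l) * gauss_extension B p" ..
    \<comment> \<open>The constant changes sign because \<open>gauss_extension\<close> contains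
      \<open>A\<close> negatively.\<close>
    from AE_pair[OF this]
    have "AE E in \<nu>. AE x in lborel. A E (closest_point E x) - B E (closest_point E x) = - c
        \<and> H E (closest_point E x) = l * A E (closest_point E x) + (1 - l) * B E (closest_point E x)"
    proof (rule eventually_mono)
      fix E assume "AE x in lborel. gauss_extension A (E, x) - gauss_extension B (E, x) = c
        \<and> gauss_extension H (E, x) = l * gauss_extension A (E, x) + (1 - l) * gauss_extension B (E, x)"
      then show "AE x in lborel. A E (closest_point E x) - B E (closest_point E x) = - c
        \<and> H E (closest_point E x) = l * A E (closest_point E x) + (1 - l) * B E (closest_point E x)"
      proof (rule eventually_mono)
        fix x
        have aux: "- h - w = l * (- a - w) + (1 - l) * (- b - w) \<Longrightarrow> h = l * a + (1 - l) * b"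
          for a b h w :: real by algebra
        assume "gauss_extension A (E, x) - gauss_extension B (E, x) = c
            \<and> gauss_extension H (E, x) = l * gauss_extension A (E, x) + (1 - l) * gauss_extension B (E, x)"
        note eqs = this[unfolded gauss_extension_def fst_conv snd_conv]
        show "A E (closest_point E x) - B E (closest_point E x) = - c
            \<and> H E (closest_point E x) = l * A E (closest_point E x) + (1 - l) * B E (closest_point E x)"
          using conjunct1[OF eqs] aux[OF conjunct2[OF eqs]] by linarith
      qed
    qed
    then show ?thesis unfolding \<nu>_def by blast
  qed
qed

section \<open>Almost all subspaces have a dense union\<close>

lemma borel_measurable_closest_point_grassmann_borel:
  "(\<lambda>E. closest_point E x) \<in> borel_measurable (grassmann_borel j)"
proof -
  have "(\<lambda>E. matrix (closest_point E)) \<in> measurable (grassmann_borel j) borel"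
    unfolding grassmann_borel_def by (rule measurable_vimage_algebra1) auto
  then have "(\<lambda>E. matrix (closest_point E) *v x) \<in> borel_measurable (grassmann_borel j)"
    by (intro borel_measurable_matrix_vector) auto
  then show ?thesis
    by (rule measurable_cong[THEN iffD1, rotated])
       (auto simp: grassmannian_def matrix_closest_point_works)
qed

text \<open>By rotation invariance all caps of the sphere are met by the same proportion of subspaces;
  finitely many caps cover the sphere, so this proportion is positive.\<close>

lemma AE_grassmann_haar_dense_unit:
  fixes u :: "real^'n"
  assumes n: "CARD('n) \<ge> 2" and j: "1 \<le> j" "j \<le> CARD('n)"
    and P: "AE E in grassmann_haar j. P E" and u: "norm u = 1" and e: "e > 0"
  shows "\<exists>E v. E \<in> grassmannian j \<and> P E \<and> v \<in> E \<and> dist u v < e"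
proof (rule ccontr)
  assume no: "\<not> ?thesis"
  define \<nu> where "\<nu> = (grassmann_haar j :: (real^'n) set measure)"
  interpret prob_space \<nu> unfolding \<nu>_def by (rule prob_space_grassmann_haar[OF j(2)])
  have s: "sets \<nu> = sets (grassmann_borel j)" and sp: "space \<nu> = grassmannian j"
    unfolding \<nu>_def using sets_grassmann_haar space_grassmann_haar j(2) by blast+
  define A where "A x = {E \<in> grassmannian j. \<exists>v\<in>E. dist x v < e}" for x :: "real^'n"
  \<comment> \<open>Meeting the ball around \<open>x\<close> is expressed through the nearest point
    of \<open>E\<close>, which depends measurably on \<open>E\<close>.\<close>
  have A_eq: "A x = {E \<in> grassmannian j. dist x (closest_point E x) < e}" for x
  proof -
    have "(\<exists>v\<in>E. dist x v < e) \<longleftrightarrow> dist x (closest_point E x) < e" if "E \<in> grassmannian j" for E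
    proof -
      have E: "subspace E" using that by (simp add: grassmannian_def)
      then show ?thesis
        using closest_point_le[of E _ x] closest_point_subspace(1)[OF E, of x] closed_subspace[OF E]
        by (meson le_less_trans)
    qed
    then show ?thesis by (auto simp: A_def)
  qed
  have A[measurable]: "A x \<in> sets \<nu>" for x
  proof -
    have [measurable]: "(\<lambda>E. closest_point E x) \<in> borel_measurable (grassmann_borel j)"
      by (rule borel_measurable_closest_point_grassmann_borel)
    have "{E \<in> space (grassmann_borel j). dist x (closest_point E x) < e} \<in> sets (grassmann_borel j)"
      by measurable
    then show ?thesis by (simp add: A_eq s)
  qed
  have "AE E in \<nu>. E \<notin> A u"
    using P[folded \<nu>_def] AE_space by eventually_elim (use no in \<open>auto simp: A_def\<close>)
  then have null_u: "emeasure \<nu> (A u) = 0"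
    using AE_iff_null_sets[OF A, of u] by auto
  \<comment> \<open>A rotation taking \<open>u\<close> to \<open>x\<close> exists in dimension at
    least 2; it maps the null event at \<open>u\<close> onto a set covering the event at
    \<open>x\<close>.\<close>
  have null: "A x \<in> null_sets \<nu>" if x: "norm x = 1" for x
  proof -
    obtain f where f: "orthogonal_transformation f" "det (matrix f) = 1" "f u = x"
      using rotation_exists_1[OF n u x] by blast
    define Q where "Q = matrix f"
    have Qf: "(*v) Q = f"
      using f(1) by (simp add: Q_def matrix_of_matrix_vector_mul orthogonal_transformation_linear fun_eq_iff)
    have Q: "rotation_matrix Q"
      using f by (simp add: Q_def rotation_matrix_def orthogonal_transformation_matrix)
    have Q': "rotation_matrix (transpose Q)"
      using Q by (simp add: rotation_matrix_def orthogonal_matrix_transpose)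
    have QQ: "Q ** transpose Q = mat 1" "transpose Q ** Q = mat 1"
      using Q by (auto simp: rotation_matrix_def orthogonal_matrix_def)
    have "A x \<subseteq> (\<lambda>E. (*v) Q ` E) ` A u"
    proof
      fix E assume "E \<in> A x"
      then obtain v where E: "E \<in> grassmannian j" and v: "v \<in> E" "dist x v < e" by (auto simp: A_def)
      define F where "F = (*v) (transpose Q) ` E"
      have "F \<in> grassmannian j" unfolding F_def by (rule rotation_image_grassmannian[OF Q' E])
      moreover have "dist u (transpose Q *v v) < e"
      proof -
        have "transpose Q *v (Q *v u) = u"
          by (simp only: matrix_vector_mul_assoc QQ matrix_vector_mul_lid)
        then have "u = transpose Q *v x" using f(3) Qf by metis
        then have "dist u (transpose Q *v v) = norm (transpose Q *v (x - v))"
          by (simp add: dist_norm matrix_vector_mult_diff_distrib del: transpose_matrix_vector)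
        also have "\<dots> = norm (x - v)"
          by (rule orthogonal_transformation_norm[OF orthogonal_transformation_rotation[OF Q']])
        finally show ?thesis using v(2) by (simp add: dist_norm)
      qed
      ultimately have "F \<in> A u" using v(1) by (auto simp: A_def F_def)
      moreover have "E = (*v) Q ` F"
        by (simp add: F_def image_image matrix_vector_mul_assoc QQ del: transpose_matrix_vector)
      ultimately show "E \<in> (\<lambda>E. (*v) Q ` E) ` A u" by blast
    qed
    moreover have "(\<lambda>E. (*v) Q ` E) ` A u \<in> sets \<nu>"
      using rotation_image_sets[OF Q] A by (simp add: s)
    ultimately have "emeasure \<nu> (A x) \<le> emeasure \<nu> ((\<lambda>E. (*v) Q ` E) ` A u)"
      by (rule emeasure_mono)
    also have "\<dots> = 0"
      using emeasure_grassmann_haar_rotation[OF j(2) Q, folded \<nu>_def, OF A] null_u by simp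
    finally show ?thesis using A by (simp add: null_sets_def)
  qed
  obtain K where K: "K \<subseteq> sphere (0 :: real^'n) 1" "finite K" "sphere 0 1 \<subseteq> (\<Union>x\<in>K. ball x e)"
  proof (rule compactE_image[OF compact_sphere[of "0 :: real^'n" 1], of "sphere 0 1" "\<lambda>x. ball x e"])
    show "sphere 0 1 \<subseteq> (\<Union>x\<in>sphere (0 :: real^'n) 1. ball x e)" using e by force
  qed auto
  \<comment> \<open>Since \<open>j\<close> is at least 1, every subspace contains a unit vector,
    which lies in one of the finitely many caps.\<close>
  have "grassmannian j \<subseteq> (\<Union>x\<in>K. A x)"
  proof
    fix E :: "(real^'n) set" assume E: "E \<in> grassmannian j"
    then have sub: "subspace E" and "dim E \<noteq> 0" using j by (auto simp: grassmannian_def)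
    then obtain v where v: "v \<in> E" "v \<noteq> 0" by (metis dim_eq_0 singletonI subsetI)
    then have "v /\<^sub>R norm v \<in> sphere 0 1" by simp
    from subsetD[OF K(3) this] obtain x where "x \<in> K" "dist x (v /\<^sub>R norm v) < e" by auto
    moreover have "v /\<^sub>R norm v \<in> E" using v sub subspace_scale by blast
    ultimately show "E \<in> (\<Union>x\<in>K. A x)" using E by (auto simp: A_def)
  qed
  moreover have "(\<Union>x\<in>K. A x) \<in> null_sets \<nu>"
    using K null by (intro null_sets.finite_UN) auto
  ultimately have "space \<nu> \<in> null_sets \<nu>"
    unfolding sp[symmetric] by (rule null_sets_subset[rotated 2]) auto
  then show False using emeasure_space_1 by auto
qed

lemma AE_grassmann_haar_dense:
  fixes u :: "real^'n"
  assumes n: "CARD('n) \<ge> 2" and j: "1 \<le> j" "j \<le> CARD('n)"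
    and P: "AE E in grassmann_haar j. P E" and e: "e > 0"
  shows "\<exists>E v. E \<in> grassmannian j \<and> P E \<and> v \<in> E \<and> dist u v < e"
proof (cases "u = 0")
  case True
  obtain w :: "real^'n" where "norm w = 1" using vector_choose_size[of 1] by auto
  from AE_grassmann_haar_dense_unit[OF n j P this e] obtain E where "E \<in> grassmannian j" "P E" by blast
  moreover have "0 \<in> E" using \<open>E \<in> grassmannian j\<close> by (simp add: grassmannian_def subspace_0)
  ultimately show ?thesis using True e by (intro exI[of _ E] exI[of _ 0]) auto
next
  case False
  then have "norm (u /\<^sub>R norm u) = 1" "e / norm u > 0" using e by simp_all
  from AE_grassmann_haar_dense_unit[OF n j P this]
  obtain E v where Ev: "E \<in> grassmannian j" "P E" "v \<in> E" "dist (u /\<^sub>R norm u) v < e / norm u" by blast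
  have "norm u *\<^sub>R v \<in> E" using Ev by (auto simp: grassmannian_def intro: subspace_scale)
  moreover have "dist u (norm u *\<^sub>R v) < e"
  proof -
    have "u - norm u *\<^sub>R v = norm u *\<^sub>R (u /\<^sub>R norm u - v)" using False by (simp add: scaleR_diff_right)
    then have "dist u (norm u *\<^sub>R v) = norm u * dist (u /\<^sub>R norm u) v" by (simp only: dist_norm norm_scaleR) simp
    also have "\<dots> < norm u * (e / norm u)" using Ev(4) False by (intro mult_strict_left_mono) auto
    finally show ?thesis using False by simp
  qed
  ultimately show ?thesis using Ev by blast
qed

section \<open>Projections of functions\<close>

lemma proj_fun_le:
  assumes f: "f \<in> pos_hom_polys d" and d: "d > 0" and z: "z \<in> E\<^sup>\<bottom>"
  shows "proj_fun E f y \<le> f (y + z)"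
  unfolding proj_fun_def
  using pos_hom_polys_nonneg[OF f d] by (intro cINF_lower z bdd_belowI2[of _ 0]) auto

lemma proj_fun_ge: "(\<And>z. z \<in> E\<^sup>\<bottom> \<Longrightarrow> m \<le> f (y + z)) \<Longrightarrow> m \<le> proj_fun E f y"
  unfolding proj_fun_def using subspace_0[OF subspace_orthogonal_comp[of E]]
  by (intro cINF_greatest) auto

lemma proj_fun_less:
  assumes "proj_fun E f y < a"
  obtains z where "z \<in> E\<^sup>\<bottom>" "f (y + z) < a"
  using proj_fun_ge[of E a f y] assms by (meson not_le)

text \<open>The shift only reparametrises the set over which the infimum is taken.\<close>

lemma proj_fun_add_orthogonal:
  assumes f: "f \<in> pos_hom_polys d" and d: "d > 0" and w: "w \<in> E\<^sup>\<bottom>"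
  shows "proj_fun E f (y + w) = proj_fun E f y"
proof (rule antisym)
  note S = subspace_orthogonal_comp[of E]
  show "proj_fun E f (y + w) \<le> proj_fun E f y"
  proof (rule proj_fun_ge)
    fix z assume "z \<in> E\<^sup>\<bottom>"
    then show "proj_fun E f (y + w) \<le> f (y + z)"
      using proj_fun_le[OF f d subspace_diff[OF S _ w], of z "y + w"] by simp
  qed
  show "proj_fun E f y \<le> proj_fun E f (y + w)"
  proof (rule proj_fun_ge)
    fix z assume "z \<in> E\<^sup>\<bottom>"
    then show "proj_fun E f y \<le> f (y + w + z)"
      using proj_fun_le[OF f d subspace_add[OF S w], of z y] by (simp add: add.assoc)
  qed
qed

lemma closest_point_orthogonal_comp:
  fixes E :: "'a::euclidean_space set"
  shows "subspace E \<Longrightarrow> x - closest_point E x \<in> E\<^sup>\<bottom>"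
    and "subspace E \<Longrightarrow> z \<in> E\<^sup>\<bottom> \<Longrightarrow> closest_point E z = 0"
  using closest_point_subspace(2)[of E _ x]
  by (auto simp: orthogonal_comp_def orthogonal_def inner_commute subspace_0 intro!: closest_point_subspaceI)

lemma proj_fun_closest_point:
  assumes f: "f \<in> pos_hom_polys d" and d: "d > 0" and E: "subspace E"
  shows "proj_fun E f (closest_point E x) = proj_fun E f x"
  using proj_fun_add_orthogonal[OF f d closest_point_orthogonal_comp(1)[OF E], of "closest_point E x" x] by simp

text \<open>Near-minimisers over points of a ball stay in a larger fixed ball, on which
  \<open>f\<close> is uniformly continuous. Reusing the shift \<open>z\<close> of one point for a
  nearby point gives a one-sided estimate, and exchanging the points gives the other side.\<close>

lemma continuous_on_proj_fun:
  fixes f :: "real^'n \<Rightarrow> real"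
  assumes f: "f \<in> pos_hom_polys d" and d: "d \<ge> 2"
  shows "continuous_on UNIV (proj_fun E f)"
proof -
  have d0: "d > 0" using d by simp
  note cont = pos_hom_polysD(4)[OF f]
  obtain c where c: "c > 0" "\<And>x. c * (norm x)\<^sup>2 - c \<le> f x"
    using pos_hom_polys_quadratic_bound[OF f d] by blast
  have "continuous_on (ball 0 r) (proj_fun E f)" for r
  proof -
    have "bdd_above (f ` cball 0 r)"
      by (intro bounded_imp_bdd_above compact_imp_bounded compact_continuous_image cont compact_cball)
    then obtain M where M: "\<And>x. x \<in> cball 0 r \<Longrightarrow> f x \<le> M" by (metis bdd_above.E imageI)
    \<comment> \<open>Coercivity confines all points with value at most \<open>M + 1\<close> to this
      radius; the slack 1 leaves room for near-minimisers, as the infimum itself is at most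
      \<open>M\<close>.\<close>
    define R where "R = sqrt ((M + 1 + c) / c)"
    have R: "norm x \<le> R" if "f x \<le> M + 1" for x
    proof -
      have "c * (norm x)\<^sup>2 \<le> M + 1 + c" using c(2)[of x] that by simp
      then have "(norm x)\<^sup>2 \<le> (M + 1 + c) / c" using c(1) by (simp add: pos_le_divide_eq mult.commute)
      then show ?thesis unfolding R_def by (rule real_le_rsqrt)
    qed
    have uc: "uniformly_continuous_on (cball 0 (R + 1)) f"
      by (rule compact_uniformly_continuous[OF cont compact_cball])
    have "\<exists>\<delta>>0. \<forall>x\<in>ball 0 r. \<forall>x'\<in>ball 0 r. dist x' x < \<delta> \<longrightarrow> proj_fun E f x' \<le> proj_fun E f x + e"
      if e: "e > 0" for e
    proof -
      obtain \<delta> where \<delta>: "\<delta> > 0"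
        "\<And>x x'. x \<in> cball 0 (R + 1) \<Longrightarrow> x' \<in> cball 0 (R + 1) \<Longrightarrow> dist x' x < \<delta> \<Longrightarrow> dist (f x') (f x) < e / 2"
        using uc e unfolding uniformly_continuous_on_def by (meson half_gt_zero)
      have "proj_fun E f x' \<le> proj_fun E f x + e"
        if x: "x \<in> ball 0 r" and x': "dist x' x < min \<delta> 1" for x x'
      proof -
        have "proj_fun E f x < proj_fun E f x + min (e / 2) 1" using e by simp
        then obtain z where z: "z \<in> E\<^sup>\<bottom>" "f (x + z) < proj_fun E f x + min (e / 2) 1"
          by (rule proj_fun_less)
        have "proj_fun E f x \<le> f (x + 0)"
          by (rule proj_fun_le[OF f d0 subspace_0[OF subspace_orthogonal_comp]])
        then have "f (x + z) \<le> M + 1" using z(2) M[of x] x by auto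
        then have n: "norm (x + z) \<le> R" by (rule R)
        have dd: "dist (x' + z) (x + z) = dist x' x" by (simp add: dist_norm)
        have n': "norm (x' + z) \<le> R + 1"
          using n x' norm_triangle_ineq2[of "x' + z" "x + z"] dd by (simp add: dist_norm)
        have "dist (f (x' + z)) (f (x + z)) < e / 2"
          using n n' x' dd by (intro \<delta>(2)) auto
        then have "f (x' + z) \<le> f (x + z) + e / 2" unfolding dist_real_def by linarith
        then show ?thesis using proj_fun_le[OF f d0 z(1), of x'] z(2) by linarith
      qed
      then show ?thesis using \<delta>(1) by (intro exI[of _ "min \<delta> 1"]) auto
    qed
    note usc = this
    show ?thesis
      unfolding continuous_on_iff
    proof (intro ballI allI impI)
      fix x e assume x: "x \<in> ball (0::real^'n) r" and "(e::real) > 0"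
      then obtain \<delta> where \<delta>: "\<delta> > 0" "\<And>x x'. x \<in> ball 0 r \<Longrightarrow> x' \<in> ball 0 r \<Longrightarrow> dist x' x < \<delta> \<Longrightarrow>
          proj_fun E f x' \<le> proj_fun E f x + e / 2"
        using usc[of "e / 2"] by auto
      have "dist (proj_fun E f x') (proj_fun E f x) < e" if x': "x' \<in> ball 0 r" "dist x' x < \<delta>" for x'
        using \<delta>(2)[OF x x'] \<delta>(2)[OF x'(1) x] x'(2) \<open>e > 0\<close> by (simp add: dist_commute dist_real_def)
      then show "\<exists>\<delta>>0. \<forall>x'\<in>ball 0 r. dist x' x < \<delta> \<longrightarrow> dist (proj_fun E f x') (proj_fun E f x) < e"
        using \<delta>(1) by blast
    qed
  qed
  then have "continuous_on (\<Union>r. ball (0::real^'n) r) (proj_fun E f)"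
    by (intro continuous_on_open_UN) auto
  moreover have "(\<Union>r. ball (0::real^'n) r) = UNIV"
    by (auto intro: gt_ex)
  ultimately show ?thesis by simp
qed

lemma proj_fun_quadratic_bound:
  assumes c: "c > 0" "\<And>x. c * (norm x)\<^sup>2 - c \<le> f x" and y: "y \<in> E"
  shows "c * (norm y)\<^sup>2 - c \<le> proj_fun E f y"
proof (rule proj_fun_ge)
  fix z assume "z \<in> E\<^sup>\<bottom>"
  then have "orthogonal y z" using y by (auto simp: orthogonal_comp_def orthogonal_def inner_commute)
  then have "(norm y)\<^sup>2 \<le> (norm (y + z))\<^sup>2" by (simp add: norm_add_Pythagorean)
  then have "c * (norm y)\<^sup>2 \<le> c * (norm (y + z))\<^sup>2" using c(1) by simp
  then show "c * (norm y)\<^sup>2 - c \<le> f (y + z)" using c(2)[of "y + z"] by linarith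
qed

lemma coercive_family_proj_fun:
  fixes f :: "real^'n \<Rightarrow> real"
  assumes f: "f \<in> pos_hom_polys d" and d: "d \<ge> 2"
  shows "coercive_family j (\<lambda>E. proj_fun E f)"
  unfolding coercive_family_def
proof (intro conjI ballI)
  have d0: "d > 0" using d by simp
  have fb: "f \<in> borel_measurable borel"
    by (intro borel_measurable_continuous_onI pos_hom_polysD(4)[OF f])
  show "proj_fun E f \<in> borel_measurable borel" for E
    by (intro borel_measurable_continuous_onI continuous_on_proj_fun[OF f d])
  obtain c where "c > 0" "\<And>x. c * (norm x)\<^sup>2 - c \<le> f x"
    using pos_hom_polys_quadratic_bound[OF f d] by blast
  then show "\<exists>c>0. \<forall>E\<in>grassmannian j. \<forall>y\<in>E. c * (norm y)\<^sup>2 - c \<le> proj_fun E f y"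
    using proj_fun_quadratic_bound by blast
  obtain D :: "(real^'n) set" where D: "countable D" "\<And>X. open X \<Longrightarrow> X \<noteq> {} \<Longrightarrow> \<exists>x\<in>D. x \<in> X"
    by (rule countable_dense_setE) blast
  have Dne: "D \<noteq> {}" using D(2)[of UNIV] by auto
  note f0 = pos_hom_polys_nonneg[OF f d0]
  \<comment> \<open>For joint measurability the infimum over the varying, uncountable
    \<open>E\<^sup>\<bottom>\<close> is replaced by one over a fixed countable dense set
    \<open>D\<close>, whose points are projected to \<open>E\<^sup>\<bottom>\<close>; continuity of
    \<open>f\<close> makes the two equal.\<close>
  have eq: "(INF w\<in>D. f (x + (w - closest_point E w))) = proj_fun E f (closest_point E x)"
    if E: "subspace E" for E x
    unfolding proj_fun_closest_point[OF f d0 E]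
  proof (rule antisym)
    show "proj_fun E f x \<le> (INF w\<in>D. f (x + (w - closest_point E w)))"
      using Dne proj_fun_le[OF f d0 closest_point_orthogonal_comp(1)[OF E]] by (intro cINF_greatest) auto
    let ?m = "INF w\<in>D. f (x + (w - closest_point E w))"
    define C where "C = {w. ?m \<le> f (x + (w - closest_point E w))}"
    have "continuous_on UNIV (closest_point E)"
      using linear_closest_point_subspace[OF E] by (simp add: linear_continuous_on linear_conv_bounded_linear)
    then have "closed C" unfolding C_def
      by (intro closed_Collect_le continuous_intros continuous_on_compose2[OF pos_hom_polysD(4)[OF f, of UNIV]]) auto
    moreover have "D \<subseteq> C"
      unfolding C_def using f0 by (auto intro!: cINF_lower bdd_belowI2[of _ 0])
    ultimately have "C = UNIV" using D(2)[of "- C"] by (auto simp: open_Compl)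
    show "?m \<le> proj_fun E f x"
    proof (rule proj_fun_ge)
      fix z assume "z \<in> E\<^sup>\<bottom>"
      moreover have "z \<in> C" using \<open>C = UNIV\<close> by simp
      ultimately show "?m \<le> f (x + z)" by (simp add: C_def closest_point_orthogonal_comp(2)[OF E])
    qed
  qed
  have "(\<lambda>p. INF w\<in>D. f (snd p + (w - closest_point (fst p) w))) \<in> borel_measurable (grassmann_borel j \<Otimes>\<^sub>M borel)"
  proof (intro borel_measurable_cINF D(1))
    show "(\<lambda>p. f (snd p + (w - closest_point (fst p) w))) \<in> borel_measurable (grassmann_borel j \<Otimes>\<^sub>M borel)" for w
      by (intro measurable_compose[OF _ fb] borel_measurable_add borel_measurable_diff
          borel_measurable_projection_grassmann_borel measurable_snd borel_measurable_const)
    show "bdd_below ((\<lambda>w. f (snd p + (w - closest_point (fst p) w))) ` D)" for p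
      using f0 by (intro bdd_belowI2[of _ 0])
  qed
  then show "(\<lambda>p. proj_fun (fst p) f (closest_point (fst p) (snd p))) \<in> borel_measurable (grassmann_borel j \<Otimes>\<^sub>M borel)"
    by (rule measurable_cong[THEN iffD1, rotated]) (auto simp: space_pair_measure grassmannian_def eq)
qed

lemma coercive_family_restriction:
  fixes f :: "real^'n \<Rightarrow> real"
  assumes f: "f \<in> pos_hom_polys d" and d: "d \<ge> 2"
  shows "coercive_family j (\<lambda>_. f)"
  unfolding coercive_family_def
proof (intro conjI ballI)
  have fb: "f \<in> borel_measurable borel"
    by (intro borel_measurable_continuous_onI pos_hom_polysD(4)[OF f])
  then show "f \<in> borel_measurable borel" .
  show "(\<lambda>p. f (closest_point (fst p) (snd p))) \<in> borel_measurable (grassmann_borel j \<Otimes>\<^sub>M borel)"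
    by (intro measurable_compose[OF _ fb] borel_measurable_projection_grassmann_borel measurable_snd)
  show "\<exists>c>0. \<forall>E\<in>grassmannian j. \<forall>y\<in>E. c * (norm y)\<^sup>2 - c \<le> f y"
    using pos_hom_polys_quadratic_bound[OF f d] by metis
qed

section \<open>Strict log-convexity\<close>

text \<open>Continuity turns the identities for almost every \<open>x\<close> into identities at
  every point of \<open>E\<close>, and the common value at 0 forces the constant difference to be
  0.\<close>

lemma grassmannian_strict_Holder_or_equal:
  fixes A B H :: "(real^'n) set \<Rightarrow> real^'n \<Rightarrow> real" and j :: nat
  assumes j: "j \<le> CARD('n)" and l: "0 < l" "l < 1"
    and coercive: "coercive_family j A" "coercive_family j B" "coercive_family j H"
    and le: "\<And>E y. E \<in> grassmannian j \<Longrightarrow> y \<in> E \<Longrightarrow> l * A E y + (1 - l) * B E y \<le> H E y"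
    and cont: "\<And>E. continuous_on UNIV (A E)" "\<And>E. continuous_on UNIV (B E)" "\<And>E. continuous_on UNIV (H E)"
    and zero: "\<And>E. E \<in> grassmannian j \<Longrightarrow> A E 0 = B E 0"
  defines "I \<equiv> \<lambda>F. \<integral>E. (\<integral>y. exp (- F E y) \<partial>subspace_lborel E) \<partial>grassmann_haar j"
  shows "I H < I A powr l * I B powr (1 - l) \<or>
    (AE E in grassmann_haar j. \<forall>y\<in>E. A E y = B E y \<and> H E y = l * A E y + (1 - l) * B E y)"
proof -
  have "AE E in grassmann_haar j. \<forall>y\<in>E. A E y = B E y \<and> H E y = l * A E y + (1 - l) * B E y"
    if AE: "AE E in grassmann_haar j. AE x in lborel. A E (closest_point E x) - B E (closest_point E x) = c
        \<and> H E (closest_point E x) = l * A E (closest_point E x) + (1 - l) * B E (closest_point E x)" for c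
    using AE AE_space
  proof eventually_elim
    case (elim E)
    then have G: "E \<in> grassmannian j" by (simp add: space_grassmann_haar[OF j])
    then have E: "subspace E" by (simp add: grassmannian_def)
    let ?P = "closest_point E"
    define C where "C = {x. A E (?P x) - B E (?P x) = c \<and> H E (?P x) = l * A E (?P x) + (1 - l) * B E (?P x)}"
    have P: "continuous_on UNIV ?P"
      using linear_closest_point_subspace[OF E] by (simp add: linear_continuous_on linear_conv_bounded_linear)
    note c = continuous_on_compose2[OF cont(1) P] continuous_on_compose2[OF cont(2) P]
      continuous_on_compose2[OF cont(3) P]
    have "closed C"
      unfolding C_def by (intro closed_Collect_conj closed_Collect_eq continuous_intros c) auto
    moreover have "AE x in lborel. x \<in> C" using elim(1) by (simp add: C_def)
    ultimately have C: "C = UNIV" by (intro AE_lborel_closed_imp_UNIV)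
    have P0: "?P y = y" if "y \<in> E" for y using closest_point_self[OF that] .
    have eqs: "A E y - B E y = c" "H E y = l * A E y + (1 - l) * B E y" if "y \<in> E" for y
    proof -
      have "y \<in> C" using C by simp
      then show "A E y - B E y = c" "H E y = l * A E y + (1 - l) * B E y"
        by (simp_all add: C_def P0[OF that])
    qed
    have "c = 0" using eqs(1)[OF subspace_0[OF E]] zero[OF G] by simp
    then show ?case using eqs by simp
  qed
  then show ?thesis
    using grassmannian_strict_Holder[OF j l coercive le] unfolding I_def by blast
qed

lemma powr_mean_scale:
  fixes a b x C l :: real
  assumes "C > 0" "a \<ge> 0" "b \<ge> 0" "x < a powr l * b powr (1 - l)"
  shows "C * x < (C * a) powr l * (C * b) powr (1 - l)"
proof -
  have "(C * a) powr l * (C * b) powr (1 - l) = (C powr l * C powr (1 - l)) * (a powr l * b powr (1 - l))"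
    using assms by (simp add: powr_mult)
  also have "C powr l * C powr (1 - l) = C" using \<open>C > 0\<close> by (simp flip: powr_add)
  finally show ?thesis using assms by simp
qed

lemma integrable_exp_minus_pos_hom_polys:
  fixes f :: "real^'n \<Rightarrow> real"
  assumes f: "f \<in> pos_hom_polys d" and d: "d \<ge> 2"
  shows "integrable lborel (\<lambda>x. exp (- f x))"
proof (rule integrableI_nonneg)
  have [measurable]: "f \<in> borel_measurable borel"
    by (intro borel_measurable_continuous_onI pos_hom_polysD(4)[OF f])
  show "(\<lambda>x. exp (- f x)) \<in> borel_measurable lborel" by measurable
  obtain c where c: "c > 0" "\<And>x. c * (norm x)\<^sup>2 - c \<le> f x"
    using pos_hom_polys_quadratic_bound[OF f d] by blast
  have "(\<integral>\<^sup>+x. ennreal (exp (- f x)) \<partial>lborel)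
      \<le> (\<integral>\<^sup>+x. ennreal (exp c) * ennreal (exp (- (c * (norm (x :: real^'n))\<^sup>2))) \<partial>lborel)"
  proof (rule nn_integral_mono)
    fix x :: "real^'n"
    have "- f x \<le> c - c * (norm x)\<^sup>2" using c(2)[of x] by linarith
    then show "ennreal (exp (- f x)) \<le> ennreal (exp c) * ennreal (exp (- (c * (norm x)\<^sup>2)))"
      by (simp flip: ennreal_mult exp_add)
  qed
  also have "\<dots> < \<infinity>"
    using nn_integral_exp_minus_norm_square_finite[OF c(1), where 'a="real^'n"]
    by (simp add: nn_integral_cmult ennreal_mult_less_top)
  finally show "(\<integral>\<^sup>+x. ennreal (exp (- f x)) \<partial>lborel) < \<infinity>" .
qed simp

text \<open>This is the case \<open>j = n\<close>. Equality would make the difference of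
  \<open>f\<close> and \<open>g\<close> constant, and both vanish at 0.\<close>

lemma integral_exp_minus_strict_log_convex:
  fixes f g :: "real^'n \<Rightarrow> real"
  assumes d: "d \<ge> 2" and f: "f \<in> pos_hom_polys d" and g: "g \<in> pos_hom_polys d" and ne: "f \<noteq> g"
    and l: "0 < l" "l < 1"
  defines "I \<equiv> \<lambda>f :: real^'n \<Rightarrow> real. \<integral>x. exp (- f x) \<partial>lborel"
  shows "I (\<lambda>x. l * f x + (1 - l) * g x) < I f powr l * I g powr (1 - l)"
proof -
  let ?h = "\<lambda>x. l * f x + (1 - l) * g x"
  have h: "?h \<in> pos_hom_polys d" by (rule pos_hom_polys_convex_comb[OF f g l])
  have "\<not> (AE x in lborel. - f x - - g x = c \<and> - ?h x = l * - f x + (1 - l) * - g x)" for c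
  proof
    assume "AE x in lborel. - f x - - g x = c \<and> - ?h x = l * - f x + (1 - l) * - g x"
    then have "AE x in lborel. x \<in> {x. - f x - - g x = c}" by (auto elim: eventually_mono)
    moreover have "closed {x. - f x - - g x = c}"
      by (intro closed_Collect_eq continuous_intros pos_hom_polysD(4)[OF f] pos_hom_polysD(4)[OF g])
    ultimately have "{x. - f x - - g x = c} = UNIV" by (rule AE_lborel_closed_imp_UNIV)
    then have eq: "g x - f x = c" for x by (auto simp: set_eq_iff)
    have "c = 0" using eq[of 0] pos_hom_polys_zero[OF f] pos_hom_polys_zero[OF g] d by simp
    then show False using eq ne by fastforce
  qed
  moreover have "emeasure lborel (space (lborel :: (real^'n) measure)) \<noteq> 0" by simp
  ultimately show ?thesis
    using strict_Holder_or_proportional[OF l integrable_exp_minus_pos_hom_polys[OF f d]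
        integrable_exp_minus_pos_hom_polys[OF g d] integrable_exp_minus_pos_hom_polys[OF h d]]
    unfolding I_def by (simp add: algebra_simps)
qed

section \<open>Agreement of projections or restrictions forces equality\<close>

lemma proj_fun_convex_comb_ge:
  fixes f g :: "real^'n \<Rightarrow> real"
  assumes f: "f \<in> pos_hom_polys d" and g: "g \<in> pos_hom_polys d" and d: "d > 0" and l: "0 < l" "l < 1"
  shows "l * proj_fun E f y + (1 - l) * proj_fun E g y \<le> proj_fun E (\<lambda>x. l * f x + (1 - l) * g x) y"
proof (rule proj_fun_ge)
  fix z assume z: "z \<in> E\<^sup>\<bottom>"
  show "l * proj_fun E f y + (1 - l) * proj_fun E g y \<le> l * f (y + z) + (1 - l) * g (y + z)"
    using l proj_fun_le[OF f d z] proj_fun_le[OF g d z] by (intro add_mono mult_left_mono) auto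
qed

lemma proj_fun_zero:
  fixes f :: "real^'n \<Rightarrow> real"
  assumes f: "f \<in> pos_hom_polys d" and d: "d > 0"
  shows "proj_fun E f 0 = 0"
proof (rule antisym)
  show "proj_fun E f 0 \<le> 0"
    using proj_fun_le[OF f d subspace_0[OF subspace_orthogonal_comp], of E 0] pos_hom_polys_zero[OF f d] by simp
  show "0 \<le> proj_fun E f 0" by (intro proj_fun_ge pos_hom_polys_nonneg[OF f d])
qed

lemma restrictions_agree_imp_eq:
  fixes f g :: "real^'n \<Rightarrow> real"
  assumes n: "CARD('n) \<ge> 2" and j: "1 \<le> j" "j \<le> CARD('n)"
    and f: "f \<in> pos_hom_polys d" and g: "g \<in> pos_hom_polys d"
    and AE: "AE E in grassmann_haar j. \<forall>y\<in>E. f y = g y"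
  shows "f = g"
proof -
  have "closed {x. f x = g x}"
    by (intro closed_Collect_eq pos_hom_polysD(4)[OF f] pos_hom_polysD(4)[OF g])
  moreover have "u \<in> closure {x. f x = g x}" for u
    unfolding closure_approachable
  proof (intro allI impI)
    fix e :: real assume "e > 0"
    from AE_grassmann_haar_dense[OF n j AE this]
    obtain v where "f v = g v" "dist u v < e" by blast
    then show "\<exists>y\<in>{x. f x = g x}. dist y u < e" by (auto simp: dist_commute)
  qed
  ultimately have "u \<in> {x. f x = g x}" for u by (simp add: closure_closed)
  then show ?thesis by auto
qed

text \<open>A minimiser \<open>x\<close> of \<open>h\<close> on a hyperplane with normal vector \<open>v \<in> E\<close> also minimises \<open>h\<close> on
  \<open>x + E\<^sup>\<bottom>\<close>, so equality of the projections forces \<open>f x = g x\<close>, while the gradient of \<open>h\<close> at \<open>x\<close> is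
  parallel to \<open>v\<close>. Hence the gradient of \<open>h\<close> maps the set \<open>{f = g}\<close> onto a dense set.\<close>

lemma projections_agree_imp_eq:
  fixes f g :: "real^'n \<Rightarrow> real"
  assumes n: "CARD('n) \<ge> 2" and j: "1 \<le> j" "j \<le> CARD('n)" and d: "d \<ge> 2"
    and f: "f \<in> pos_hom_polys d" and g: "g \<in> pos_hom_polys d" and l: "0 < l" "l < 1"
  defines "h \<equiv> \<lambda>x. l * f x + (1 - l) * g x"
  assumes AE: "AE E in grassmann_haar j. \<forall>y\<in>E. proj_fun E f y = proj_fun E g y
      \<and> proj_fun E h y = l * proj_fun E f y + (1 - l) * proj_fun E g y"
  shows "f = g"
proof -
  have d0: "d > 0" using d by simp
  have h: "h \<in> pos_hom_polys d" unfolding h_def by (rule pos_hom_polys_convex_comb[OF f g l])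
  obtain G where G: "polynomial_function G" "\<And>x. (h has_derivative (\<lambda>v. G x \<bullet> v)) (at x)"
    using real_polynomial_function_gradient[OF pos_hom_polysD(1)[OF h]] by blast
  show ?thesis
  proof (rule gradient_coincidence_set_dense_imp_eq[OF f g h d G])
    fix u and e :: real assume "e > 0"
    from AE_grassmann_haar_dense[OF n j AE this] obtain E v where
      Ev: "E \<in> grassmannian j" "v \<in> E" "dist u v < e" and
      eqs: "\<And>y. y \<in> E \<Longrightarrow> proj_fun E f y = proj_fun E g y"
        "\<And>y. y \<in> E \<Longrightarrow> proj_fun E h y = l * proj_fun E f y + (1 - l) * proj_fun E g y" by blast
    have E: "subspace E" using Ev(1) by (simp add: grassmannian_def)
    have "v \<in> G ` {x. f x = g x}" if v: "v \<noteq> 0"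
    proof -
      obtain x where x: "G x = v" "\<And>w. w \<bullet> v = 0 \<Longrightarrow> h x \<le> h (x + w)"
        using pos_hom_polys_hyperplane_minimiser[OF h d G(2) v] by blast
      define a where "a = proj_fun E f x"
      \<comment> \<open>The identities are known on \<open>E\<close> only; constancy of projections
        along \<open>E\<^sup>\<bottom>\<close> carries them to the minimiser \<open>x\<close>, which
        may lie outside \<open>E\<close>.\<close>
      note cp = proj_fun_closest_point[OF _ d0 E, of _ x]
      note y = closest_point_subspace(1)[OF E, of x]
      have ag: "a = proj_fun E g x" and ah: "proj_fun E h x = l * a + (1 - l) * a"
        using eqs[OF y] by (simp_all add: cp[OF f] cp[OF g] cp[OF h] a_def)
      have "h x \<le> proj_fun E h x"
      proof (rule proj_fun_ge)
        fix z assume "z \<in> E\<^sup>\<bottom>"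
        then show "h x \<le> h (x + z)"
          using Ev(2) by (intro x(2)) (auto simp: orthogonal_comp_def orthogonal_def inner_commute)
      qed
      then have "l * f x + (1 - l) * g x \<le> l * a + (1 - l) * a"
        unfolding ah by (simp add: h_def)
      \<comment> \<open>Both gaps are nonnegative because the shift 0 is admissible in the infimum,
        so a nonpositive combination with positive weights makes both vanish.\<close>
      then have le: "l * (f x - a) + (1 - l) * (g x - a) \<le> 0" by (simp add: algebra_simps)
      have ge: "f x - a \<ge> 0" "g x - a \<ge> 0"
        using proj_fun_le[OF f d0 subspace_0[OF subspace_orthogonal_comp], of E x]
          proj_fun_le[OF g d0 subspace_0[OF subspace_orthogonal_comp], of E x]
        unfolding ag by (simp_all add: a_def[symmetric] ag)
      have "l * (f x - a) \<ge> 0" "(1 - l) * (g x - a) \<ge> 0" using ge l by simp_all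
      then have "l * (f x - a) = 0" "(1 - l) * (g x - a) = 0" using le by linarith+
      then have "f x = g x" using l by simp
      then show ?thesis using x(1) by blast
    qed
    then show "\<exists>v. dist u v < e \<and> (v \<noteq> 0 \<longrightarrow> v \<in> G ` {x. f x = g x})" using Ev(3) by blast
  qed
qed

theorem corollary4p7:
  fixes d j :: nat and f g :: "real^'n \<Rightarrow> real" and l :: real
  assumes "CARD('n) \<ge> 2" and "d \<ge> 2" and "even d"
    and "1 \<le> j" and "j \<le> CARD('n)"
    and "f \<in> pos_hom_polys d" and "g \<in> pos_hom_polys d" and "f \<noteq> g"
    and "0 < l" and "l < 1"
  shows "intrinsic_vol d j (\<lambda>x. l * f x + (1 - l) * g x)
           < intrinsic_vol d j f powr l * intrinsic_vol d j g powr (1 - l)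
       \<and> dual_intrinsic_vol d j (\<lambda>x. l * f x + (1 - l) * g x)
           < dual_intrinsic_vol d j f powr l * dual_intrinsic_vol d j g powr (1 - l)"
proof -
  note n = assms(1) and d = assms(2) and j = assms(4,5) and f = assms(6) and g = assms(7)
    and ne = assms(8) and l = assms(9,10)
  let ?h = "\<lambda>x. l * f x + (1 - l) * g x"
  have h: "?h \<in> pos_hom_polys d" by (rule pos_hom_polys_convex_comb[OF f g l])
  have d0: "d > 0" using d by simp
  have Gam: "Gamma (1 + real k / real d) > 0" for k by (intro Gamma_real_pos) (simp add: add_pos_nonneg)
  show ?thesis
  proof (cases "j = CARD('n)")
    case True
    have "1 / Gamma (1 + real CARD('n) / real d) > 0" using Gam by simp
    from powr_mean_scale[OF this _ _ integral_exp_minus_strict_log_convex[OF d f g ne l]]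
    show ?thesis unfolding intrinsic_vol_def dual_intrinsic_vol_def if_P[OF True] by simp
  next
    case False
    define I where "I F = (\<integral>E. (\<integral>y. exp (- F E y) \<partial>subspace_lborel E) \<partial>grassmann_haar j)"
      for F :: "(real^'n) set \<Rightarrow> real^'n \<Rightarrow> real"
    have I0: "0 \<le> I F" for F by (simp add: I_def integral_nonneg_AE)
    have "CARD('n) choose j > 0" using j by (simp add: zero_less_binomial)
    then have pos: "flag_coeff j CARD('n) / Gamma (1 + real j / real d) > 0"
        "dual_coeff j CARD('n) / Gamma (1 + real j / real d) > 0"
      using Gam by (simp_all add: flag_coeff_def dual_coeff_def unit_ball_vol_pos)
    have "I (\<lambda>E. proj_fun E ?h) < I (\<lambda>E. proj_fun E f) powr l * I (\<lambda>E. proj_fun E g) powr (1 - l)"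
      using grassmannian_strict_Holder_or_equal[OF j(2) l coercive_family_proj_fun[OF f d]
          coercive_family_proj_fun[OF g d] coercive_family_proj_fun[OF h d]
          proj_fun_convex_comb_ge[OF f g d0 l] continuous_on_proj_fun[OF f d]
          continuous_on_proj_fun[OF g d] continuous_on_proj_fun[OF h d]]
        projections_agree_imp_eq[OF n j d f g l] ne
      unfolding I_def by (auto simp: proj_fun_zero[OF f d0] proj_fun_zero[OF g d0])
    \<comment> \<open>Restriction is linear in the function, so the required pointwise inequality
      holds with equality and reflexivity suffices.\<close>
    moreover have "I (\<lambda>_. ?h) < I (\<lambda>_. f) powr l * I (\<lambda>_. g) powr (1 - l)"
      using grassmannian_strict_Holder_or_equal[OF j(2) l coercive_family_restriction[OF f d]
          coercive_family_restriction[OF g d] coercive_family_restriction[OF h d] order_refl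
          pos_hom_polysD(4)[OF f] pos_hom_polysD(4)[OF g] pos_hom_polysD(4)[OF h]]
        restrictions_agree_imp_eq[OF n j f g] ne
      unfolding I_def by (auto simp: pos_hom_polys_zero[OF f d0] pos_hom_polys_zero[OF g d0])
    ultimately show ?thesis
      unfolding intrinsic_vol_def dual_intrinsic_vol_def if_not_P[OF False] I_def[symmetric]
      by (intro conjI powr_mean_scale pos I0)
  qed
qed

end
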